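(* Let $S$ be an inverse semigroup with zero and with set of idempotents $E$. Let $\mathscr{F}$ be the groupoid of proper filters of $S$, endowed with the patch topology, and let $\mathcal{G}_0$ be the groupoid of proper germs, endowed with its topology described in the context. For $F \in \mathscr{F}$ put $\xi_F := \mathbf{d}(F) \cap E \in \mathsf{F}(E)$. The map $\pi\colon \mathscr{F} \to \mathcal{G}_0$ given by $\pi(F) := [s, \xi_F]$ for any $s \in F$ is a topological groupoid isomorphism, with inverse given by $\pi^{-1}([s,\xi]) = (s\xi)^\uparrow$, where $s\xi = \{se : e \in \xi\}$ and $(\cdot)^\uparrow$ is upward closure in $S$.
   Context: $S$ is an inverse semigroup (each $a\in S$ has a unique $a^*$ with $aa^*a=a$, $a^*aa^*=a^*$) containing $0$ with $0a=a0=0$ for all $a$. Its natural partial order is $a\le b \iff a=aa^*b$. $E=\{e\in S: ee=e\}$ is the set of idempotents, itself a commutative inverse semigroup containing $0$. For $A\subseteq S$, $A^\uparrow=\{b\in S: a\le b\text{ for some }a\in A\}$; $A^*=\{a^*:a\in A\}$; $s^\downarrow=\{b\in S: b\le s\}$; $AB=\{ab:a\in A,b\in B\}$. A filter in $S$ is a nonempty subset $F$ with $F^\uparrow=F$ that is down-directed (for $a,b\in F$ there is $c\in F$ with $c\le a,b$). It is proper if $0\notin F$. $\mathscr{F}$ is the set of proper filters in $S$. For filters $F,G$ put $F\cdot G=(FG)^\uparrow$. $\mathscr{F}$ is a groupoid with composable pairs $\{(F,G): F^*\cdot F=G\cdot G^*\}$, composition $(F,G)\mapsto F\cdot G$, inversion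 $F\mapsto F^*$; the source map is $\mathbf{d}(F)=F^*\cdot F$. The patch topology on $\mathscr{F}$ has basis $\mathscr{F}_{s:T}=\{F\in\mathscr{F}: s\in F\subseteq S\setminus T\}$, for $s\in S$ and finite $T\subseteq s^\downarrow$. $\mathsf{F}(E)$ is the set of proper filters in the inverse semigroup $E$ (nonempty down-directed up-sets of $E$ not containing $0$). The patch topology on $\mathsf{F}(E)$ has basis $\mathsf{F}_{e:X}=\{\xi\in\mathsf{F}(E): e\in\xi\subseteq E\setminus X\}$, for $e\in E$ and finite $X\subseteq e^\downarrow$. Put $\mathsf{F}_e=\{\xi\in\mathsf{F}(E):e\in\xi\}$. Groupoid of proper germs: on $\Omega=\{(s,\xi)\in S\times\mathsf{F}(E):\xi\in\mathsf{F}_{s^*s}\}$ define the equivalence relation $(s,\xi)\sim(t,\eta)$ iff $\xi=\eta$ and there is $e\in\xi$ with $se=te$; write $[s,\xi]$ for the class of $(s,\xi)$ and $\mathcal{G}_0=\Omega/\!\sim$. For $s\in S$, $\xi\in\mathsf{F}_{s^*s}$, let $\beta_s(\xi)=\{f\in E: ses^*\le f\text{ for some }e\in\xi\}\in\mathsf{F}_{ss^*}$. Composable pairs are the $([s,\xi],[t,\eta])$ with $\xi=\beta_t(\eta)$, with composition $[s,\beta_t(\eta)][t,\eta]=[st,\eta]$ and inversion $[s,\xi]^{-1}=[s^*,\beta_s(\xi)]$. The topology on $\mathcal{G}_0$ has as basis the sets $\Theta_0(s,A)=\{[s,\xi]:\xi\in A\}$, for $s\in S$ and $A\subseteq\mathsf{F}_{s^*s}$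 open in the patch topology of $\mathsf{F}(E)$. A groupoid isomorphism is a bijection $\phi\colon\mathcal{G}\to\mathcal{H}$ such that for every composable pair $(\alpha,\beta)$ in $\mathcal{G}$, $(\phi(\alpha),\phi(\beta))$ is composable in $\mathcal{H}$ and $\phi(\alpha\beta)=\phi(\alpha)\phi(\beta)$. A topological groupoid isomorphism is a groupoid isomorphism between topological groupoids that is also a homeomorphism. It is a fact that $\xi_F\in\mathsf{F}(E)$ and that $[s,\xi_F]=[t,\xi_F]$ for all $s,t\in F$. *)

theory Defs
  imports "HOL-Analysis.Analysis"
begin

section \<open>Inverse semigroups with zero\<close>

text \<open>The inverse semigroup is the whole type; since it contains \<open>0\<close>, this loses no generality.\<close>

class inverse_semigroup_zero = semigroup_mult + mult_zero +
  fixes star :: "'a \<Rightarrow> 'a"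
  assumes mult_star_mult: "a * star a * a = a"
    and star_mult_star: "star a * a * star a = star a"
    and star_unique: "a * b * a = a \<Longrightarrow> b * a * b = b \<Longrightarrow> b = star a"

definition nat_le :: "'a::inverse_semigroup_zero \<Rightarrow> 'a \<Rightarrow> bool" (infix "\<preceq>" 50)
  where "a \<preceq> b \<longleftrightarrow> a = a * star a * b"

definition idems :: "'a::inverse_semigroup_zero set"
  where "idems = {e. e * e = e}"

definition set_mult :: "'a::inverse_semigroup_zero set \<Rightarrow> 'a set \<Rightarrow> 'a set"
  where "set_mult A B = {a * b | a b. a \<in> A \<and> b \<in> B}"


section \<open>Filters and the patch topology\<close>

text \<open>
  These notions are relative to an inverse subsemigroup \<open>C\<close> containing \<open>0\<close>; they are used with
  \<open>C = UNIV\<close> (the semigroup \<open>S\<close> itself) and with \<open>C = idems\<close> (the inverse semigroup \<open>E\<close>, whose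
  natural order and star are the restrictions of those of \<open>S\<close>).
\<close>

definition up_in :: "'a::inverse_semigroup_zero set \<Rightarrow> 'a set \<Rightarrow> 'a set"
  where "up_in C A = {b \<in> C. \<exists>a\<in>A. a \<preceq> b}"

definition down_in :: "'a::inverse_semigroup_zero set \<Rightarrow> 'a \<Rightarrow> 'a set"
  where "down_in C s = {b \<in> C. b \<preceq> s}"

definition filter_in :: "'a::inverse_semigroup_zero set \<Rightarrow> 'a set \<Rightarrow> bool"
  where "filter_in C F \<longleftrightarrow> F \<noteq> {} \<and> F \<subseteq> C \<and> up_in C F = F \<and>
    (\<forall>a\<in>F. \<forall>b\<in>F. \<exists>c\<in>F. c \<preceq> a \<and> c \<preceq> b)"

definition proper_filters :: "'a::inverse_semigroup_zero set \<Rightarrow> 'a set set"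
  where "proper_filters C = {F. filter_in C F \<and> 0 \<notin> F}"

definition patch_basic :: "'a::inverse_semigroup_zero set \<Rightarrow> 'a \<Rightarrow> 'a set \<Rightarrow> 'a set set"
  where "patch_basic C s T = {F \<in> proper_filters C. s \<in> F \<and> F \<subseteq> C - T}"

text \<open>
  The generating sets form a base; likewise for \<open>germ_topology\<close> below. So \<open>topology_generated_by\<close>,
  which only takes a subbase, yields the topology with that base.
\<close>

definition patch_topology :: "'a::inverse_semigroup_zero set \<Rightarrow> 'a set topology"
  where "patch_topology C =
    topology_generated_by {patch_basic C s T | s T. s \<in> C \<and> finite T \<and> T \<subseteq> down_in C s}"


section \<open>Topological groupoids\<close>

record 'g groupoid =
  arrows :: "'g set"
  composable :: "('g \<times> 'g) set"
  gmult :: "'g \<Rightarrow> 'g \<Rightarrow> 'g"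
  ginv :: "'g \<Rightarrow> 'g"

definition is_groupoid :: "'g groupoid \<Rightarrow> bool"
  where "is_groupoid G \<longleftrightarrow>
    composable G \<subseteq> arrows G \<times> arrows G \<and>
    (\<forall>(a, b) \<in> composable G. gmult G a b \<in> arrows G) \<and>
    (\<forall>a \<in> arrows G. ginv G a \<in> arrows G \<and> ginv G (ginv G a) = a) \<and>
    (\<forall>a b c. (a, b) \<in> composable G \<and> (b, c) \<in> composable G \<longrightarrow>
       (gmult G a b, c) \<in> composable G \<and> (a, gmult G b c) \<in> composable G \<and>
       gmult G (gmult G a b) c = gmult G a (gmult G b c)) \<and>
    (\<forall>a \<in> arrows G. (ginv G a, a) \<in> composable G) \<and>
    (\<forall>(a, b) \<in> composable G.
       gmult G (ginv G a) (gmult G a b) = b \<and> gmult G (gmult G a b) (ginv G b) = a)"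

definition is_topological_groupoid :: "'g groupoid \<Rightarrow> 'g topology \<Rightarrow> bool"
  where "is_topological_groupoid G X \<longleftrightarrow>
    is_groupoid G \<and> topspace X = arrows G \<and>
    continuous_map (subtopology (prod_topology X X) (composable G)) X (\<lambda>(a, b). gmult G a b) \<and>
    continuous_map X X (ginv G)"

definition groupoid_isomorphism :: "'g groupoid \<Rightarrow> 'h groupoid \<Rightarrow> ('g \<Rightarrow> 'h) \<Rightarrow> bool"
  where "groupoid_isomorphism G H \<phi> \<longleftrightarrow>
    is_groupoid G \<and> is_groupoid H \<and> bij_betw \<phi> (arrows G) (arrows H) \<and>
    (\<forall>(a, b) \<in> composable G.
       (\<phi> a, \<phi> b) \<in> composable H \<and> \<phi> (gmult G a b) = gmult H (\<phi> a) (\<phi> b))"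

definition topological_groupoid_isomorphism ::
    "'g groupoid \<Rightarrow> 'g topology \<Rightarrow> 'h groupoid \<Rightarrow> 'h topology \<Rightarrow> ('g \<Rightarrow> 'h) \<Rightarrow> bool"
  where "topological_groupoid_isomorphism G X H Y \<phi> \<longleftrightarrow>
    is_topological_groupoid G X \<and> is_topological_groupoid H Y \<and>
    groupoid_isomorphism G H \<phi> \<and> homeomorphic_map X Y \<phi>"


section \<open>The groupoid of proper filters\<close>

definition filter_mult :: "'a::inverse_semigroup_zero set \<Rightarrow> 'a set \<Rightarrow> 'a set"
  where "filter_mult F G = up_in UNIV (set_mult F G)"

definition filter_source :: "'a::inverse_semigroup_zero set \<Rightarrow> 'a set"
  where "filter_source F = filter_mult (star ` F) F"

definition filter_groupoid :: "'a::inverse_semigroup_zero set groupoid"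
  where "filter_groupoid = \<lparr>
    arrows = proper_filters UNIV,
    composable = {(F, G). F \<in> proper_filters UNIV \<and> G \<in> proper_filters UNIV \<and>
                          filter_mult (star ` F) F = filter_mult G (star ` G)},
    gmult = filter_mult,
    ginv = (`) star\<rparr>"


section \<open>The groupoid of proper germs\<close>

definition idem_filters_at :: "'a::inverse_semigroup_zero \<Rightarrow> 'a set set"
  where "idem_filters_at e = {\<xi> \<in> proper_filters idems. e \<in> \<xi>}"

definition germ_pairs :: "('a::inverse_semigroup_zero \<times> 'a set) set"
  where "germ_pairs = {(s, \<xi>). \<xi> \<in> idem_filters_at (star s * s)}"

definition germ_rel :: "(('a::inverse_semigroup_zero \<times> 'a set) \<times> ('a \<times> 'a set)) set"
  where "germ_rel = {((s, \<xi>), (t, \<eta>)). (s, \<xi>) \<in> germ_pairs \<and> (t, \<eta>) \<in> germ_pairs \<and>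
                       \<xi> = \<eta> \<and> (\<exists>e\<in>\<xi>. s * e = t * e)}"

definition germ :: "'a::inverse_semigroup_zero \<Rightarrow> 'a set \<Rightarrow> ('a \<times> 'a set) set"
  where "germ s \<xi> = germ_rel `` {(s, \<xi>)}"

definition germ_action :: "'a::inverse_semigroup_zero \<Rightarrow> 'a set \<Rightarrow> 'a set"
  where "germ_action s \<xi> = {f \<in> idems. \<exists>e\<in>\<xi>. s * e * star s \<preceq> f}"

definition germ_groupoid :: "('a::inverse_semigroup_zero \<times> 'a set) set groupoid"
  where "germ_groupoid = \<lparr>
    arrows = germ_pairs // germ_rel,
    composable = {(germ s \<xi>, germ t \<eta>) | s \<xi> t \<eta>.
                    (s, \<xi>) \<in> germ_pairs \<and> (t, \<eta>) \<in> germ_pairs \<and> \<xi> = germ_action t \<eta>},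
    gmult = (\<lambda>\<alpha> \<beta>. THE \<gamma>. \<exists>s t \<eta>.
               (s, germ_action t \<eta>) \<in> germ_pairs \<and> (t, \<eta>) \<in> germ_pairs \<and>
               \<alpha> = germ s (germ_action t \<eta>) \<and> \<beta> = germ t \<eta> \<and> \<gamma> = germ (s * t) \<eta>),
    ginv = (\<lambda>\<alpha>. THE \<gamma>. \<exists>s \<xi>. (s, \<xi>) \<in> germ_pairs \<and>
               \<alpha> = germ s \<xi> \<and> \<gamma> = germ (star s) (germ_action s \<xi>))\<rparr>"

definition germ_basic :: "'a::inverse_semigroup_zero \<Rightarrow> 'a set set \<Rightarrow> ('a \<times> 'a set) set set"
  where "germ_basic s A = {germ s \<xi> | \<xi>. \<xi> \<in> A}"

definition germ_topology :: "('a::inverse_semigroup_zero \<times> 'a set) set topology"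
  where "germ_topology = topology_generated_by
    {germ_basic s A | s A. A \<subseteq> idem_filters_at (star s * s) \<and> openin (patch_topology idems) A}"


section \<open>The map from filters to germs\<close>

definition idem_source :: "'a::inverse_semigroup_zero set \<Rightarrow> 'a set"
  where "idem_source F = filter_source F \<inter> idems"

text \<open>The value does not depend on the chosen element of \<open>F\<close>.\<close>

definition filter_to_germ :: "'a::inverse_semigroup_zero set \<Rightarrow> ('a \<times> 'a set) set"
  where "filter_to_germ F = germ (SOME s. s \<in> F) (idem_source F)"

end

theory Submission
  imports Defs
begin

text \<open>
  A filter \<open>F\<close> is recovered from any \<open>s \<in> F\<close> and the idempotent part \<open>\<xi>\<close> of its source, because
  an idempotent \<open>e\<close> lies in \<open>\<xi>\<close> iff \<open>s e \<in> F\<close>, and every element of \<open>F\<close> lies above some \<open>s e\<close> with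
  \<open>e \<in> \<xi>\<close>. Hence \<open>F\<close> is sent to the germ \<open>[t, \<eta>]\<close> exactly when \<open>t \<in> F\<close> and \<open>\<eta> = \<xi>\<close>, which gives the
  bijection and shows that the germ operations are the filter operations transported along it.
  Associativity and \<open>F \<cdot> F\<^sup>* \<cdot> F = F\<close> already yield the groupoid laws for filters. If \<open>(F, G)\<close> is
  composable and \<open>a \<in> F\<close>, then \<open>x \<in> F \<cdot> G\<close> iff \<open>a\<^sup>* x \<in> G\<close>, so near \<open>(F, G)\<close> the product lies in a
  basic open set iff \<open>G\<close> lies in its translate by \<open>a\<^sup>*\<close>; translates of basic open sets
  likewise give continuity of \<open>F \<mapsto> \<xi>\<close>, of the bijection and of its inverse.
\<close>


section \<open>Inverse semigroups\<close>

lemma star_star [simp]: "star (star a) = (a::'a::inverse_semigroup_zero)"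
  by (metis mult_star_mult star_mult_star star_unique)

text \<open>The defining equations in right-nested form, also with a trailing factor, so that they
  still fire inside longer products after normalising with \<open>mult.assoc\<close>.\<close>

lemma mult_star_mult_left [simp]:
  "(a::'a::inverse_semigroup_zero) * (star a * a) = a" "a * (star a * (a * b)) = a * b"
  "star a * (a * star a) = star a" "star a * (a * (star a * b)) = star a * b"
  by (metis mult.assoc mult_star_mult star_mult_star)+

lemma idemsI: "e * e = e \<Longrightarrow> e \<in> idems"
  and idemsD: "e \<in> idems \<Longrightarrow> e * e = e"
  by (auto simp: idems_def)

lemma star_idem: "e \<in> idems \<Longrightarrow> star e = e"
  by (metis idemsD star_unique)

lemma zero_idem [simp]: "0 \<in> idems"
  by (simp add: idems_def)

lemma star_mult_idem [simp]: "star a * a \<in> idems" "a * star a \<in> idems"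
  by (auto simp: idems_def mult.assoc)

lemma idem_mult:
  assumes "e \<in> idems" "f \<in> idems"
  shows "e * f \<in> idems"
proof -
  define x where "x = star (e * f)"
  have ee: "e * e = e" "f * f = f" using assms by (auto simp: idems_def)
  \<comment> \<open>\<open>f * x * e\<close> is another inverse of \<open>e * f\<close>, hence equal to \<open>x\<close>; this makes \<open>x\<close> idempotent.\<close>
  have x1: "e * f * x * (e * f) = e * f" and x2: "x * (e * f) * x = x"
    unfolding x_def by (simp_all add: mult_star_mult star_mult_star)
  have "(e * f) * (f * x * e) * (e * f) = e * (f * f) * x * (e * e) * f"
    by (simp only: mult.assoc)
  also have "\<dots> = e * f" using x1 by (simp add: ee mult.assoc)
  finally have 1: "(e * f) * (f * x * e) * (e * f) = e * f" .
  have "(f * x * e) * (e * f) * (f * x * e) = f * x * (e * e) * (f * f) * x * e"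
    by (simp only: mult.assoc)
  also have "\<dots> = f * (x * (e * f) * x) * e" by (simp only: ee mult.assoc)
  also have "\<dots> = f * x * e" by (simp only: x2)
  finally have 2: "(f * x * e) * (e * f) * (f * x * e) = f * x * e" .
  from star_unique[OF 1 2] have x: "f * x * e = x" by (simp add: x_def)
  have "x * x = (f * x * e) * (f * x * e)" by (simp only: x)
  also have "\<dots> = f * (x * (e * f) * x) * e" by (simp only: mult.assoc)
  also have "\<dots> = x" by (simp only: x2 x)
  finally have "x \<in> idems" by (rule idemsI)
  moreover from star_idem[OF this] have "e * f = x" by (simp add: x_def)
  ultimately show ?thesis by simp
qed

text \<open>By \<open>idem_mult\<close> both products are idempotent, which makes
  \<open>f * e\<close> an inverse of \<open>e * f\<close>. An idempotent is its own star, so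
  uniqueness of inverses identifies the two.\<close>

lemma idem_commute:
  assumes "e \<in> idems" "f \<in> idems"
  shows "e * f = f * e"
proof -
  have ee: "e * e = e" "f * f = f" using assms by (auto simp: idems_def)
  have ef: "e * f * (e * f) = e * f" "f * e * (f * e) = f * e"
    using idem_mult assms by (auto simp: idems_def)
  have "(e * f) * (f * e) * (e * f) = e * (f * f) * (e * e) * f" by (simp only: mult.assoc)
  also have "\<dots> = e * f" using ef by (simp add: ee mult.assoc)
  finally have 1: "(e * f) * (f * e) * (e * f) = e * f" .
  have "(f * e) * (e * f) * (f * e) = f * (e * e) * (f * f) * e" by (simp only: mult.assoc)
  also have "\<dots> = f * e" using ef by (simp add: ee mult.assoc)
  finally have 2: "(f * e) * (e * f) * (f * e) = f * e" .
  from star_unique[OF 1 2] have "f * e = star (e * f)" .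
  then show ?thesis using star_idem[OF idem_mult[OF assms]] by simp
qed

text \<open>Commuting the adjacent idempotents \<open>b * star b\<close> and
  \<open>star a * a\<close> lets both inverse equations collapse, so uniqueness applies to
  \<open>star b * star a\<close>.\<close>

lemma star_mult: "star (a * b) = star b * star (a::'a::inverse_semigroup_zero)"
proof -
  have "(a * b) * (star b * star a) * (a * b) = a * ((b * star b) * (star a * a)) * b"
    by (simp only: mult.assoc)
  also have "\<dots> = a * ((star a * a) * (b * star b)) * b"
    using idem_commute[of "b * star b" "star a * a"] by simp
  also have "\<dots> = a * b" by (simp add: mult.assoc)
  finally have 1: "(a * b) * (star b * star a) * (a * b) = a * b" .
  have "(star b * star a) * (a * b) * (star b * star a)
      = star b * ((star a * a) * (b * star b)) * star a"
    by (simp only: mult.assoc)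
  also have "\<dots> = star b * ((b * star b) * (star a * a)) * star a"
    using idem_commute[of "b * star b" "star a * a"] by simp
  also have "\<dots> = star b * star a" by (simp add: mult.assoc)
  finally have 2: "(star b * star a) * (a * b) * (star b * star a) = star b * star a" .
  from star_unique[OF 1 2] show ?thesis by simp
qed

lemma star_0 [simp]: "star 0 = (0::'a::inverse_semigroup_zero)"
  by (simp add: star_idem)

lemma conj_idem:
  assumes "e \<in> idems"
  shows "s * e * star s \<in> idems"
proof -
  have ee: "e * e = e" using assms by (rule idemsD)
  have "(s * e * star s) * (s * e * star s) = s * (e * (star s * s)) * e * star s"
    by (simp only: mult.assoc)
  also have "\<dots> = s * (star s * s * e) * e * star s"
    using idem_commute[OF assms, of "star s * s"] by simp
  also have "\<dots> = s * (star s * s) * (e * e) * star s" by (simp only: mult.assoc)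
  also have "\<dots> = s * e * star s" by (simp add: ee)
  finally show ?thesis by (rule idemsI)
qed

text \<open>Moving an idempotent to the other side of \<open>b\<close> costs a conjugation; this is
  what makes the left-handed definition of the order equivalent to a right-handed one.\<close>

lemma idem_mult_swap: "e \<in> idems \<Longrightarrow> e * b = b * (star b * e * b)"
  using idem_commute[of e "b * star b"] by (metis mult.assoc mult_star_mult star_mult_idem(2))

section \<open>The natural partial order and its compatibility with product and star\<close>

lemma nat_le_left: "e \<in> idems \<Longrightarrow> e * b \<preceq> b"
proof -
  assume e: "e \<in> idems"
  have "(e * b) * star (e * b) * b = e * ((b * star b) * e) * b"
    by (simp add: star_mult star_idem[OF e] mult.assoc)
  also have "\<dots> = e * (e * (b * star b)) * b"
    by (simp only: idem_commute[OF e star_mult_idem(2)])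
  also have "\<dots> = (e * e) * (b * star b * b)" by (simp only: mult.assoc)
  also have "\<dots> = e * b" by (simp only: idemsD[OF e] mult_star_mult)
  finally show ?thesis by (simp add: nat_le_def)
qed

text \<open>Reduces to the left-handed case: \<open>b * e\<close> is the left multiple of
  \<open>b\<close> by the conjugate idempotent \<open>b * e * star b\<close>.\<close>

lemma nat_le_right:
  assumes e: "e \<in> idems"
  shows "b * e \<preceq> b"
proof -
  have "b * e = b * (star b * b) * e" by (simp add: mult.assoc)
  also have "\<dots> = b * e * star b * b"
    using idem_commute[OF e, of "star b * b"] by (simp add: mult.assoc)
  finally show ?thesis using nat_le_left[OF conj_idem[OF e], of b b] by simp
qed

lemma nat_leD: "a \<preceq> b \<Longrightarrow> a = a * star a * b"
  by (simp add: nat_le_def)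

text \<open>Swapping \<open>a * star a\<close> past \<open>b\<close> gives \<open>a = b * g\<close>
  with \<open>g\<close> idempotent. Then \<open>star a * a\<close> is \<open>g\<close> cut down by
  \<open>star b * b\<close>, and \<open>b\<close> absorbs the latter.\<close>

lemma nat_leD_right:
  assumes "a \<preceq> b"
  shows "a = b * (star a * a)"
proof -
  have e: "a * star a \<in> idems" by simp
  obtain g where g: "g = star b * (a * star a) * b" by blast
  have gi: "g \<in> idems" using conj_idem[OF e, of "star b"] by (simp add: g)
  have comm: "g * (star b * b) = (star b * b) * g" by (simp add: idem_commute[OF gi])
  have "a = (a * star a) * b" by (rule nat_leD[OF assms])
  also have "\<dots> = b * g" unfolding g by (rule idem_mult_swap[OF e])
  finally have a: "a = b * g" .
  have "b * (star a * a) = b * (g * (star b * b) * g)"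
    by (simp add: a star_mult star_idem[OF gi] mult.assoc)
  also have "\<dots> = b * (star b * b) * (g * g)" by (simp only: comm) (simp only: mult.assoc)
  also have "\<dots> = a" using idemsD[OF gi] by (simp add: a)
  finally show ?thesis by simp
qed

lemma nat_le_refl [simp]: "a \<preceq> a"
  by (simp add: nat_le_def mult_star_mult)

text \<open>With an arbitrary idempotent as witness, here and in the left-handed version below,
  transitivity becomes closure of idempotents under products, and monotonicity of multiplication
  becomes associativity.\<close>

lemma nat_le_iff_right: "a \<preceq> b \<longleftrightarrow> (\<exists>e\<in>idems. a = b * e)"
proof
  assume "a \<preceq> b"
  then show "\<exists>e\<in>idems. a = b * e"
    using nat_leD_right star_mult_idem(1) by blast
qed (auto simp: nat_le_right)

lemma nat_le_iff_left: "a \<preceq> b \<longleftrightarrow> (\<exists>e\<in>idems. a = e * b)"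
proof
  assume "a \<preceq> b"
  then show "\<exists>e\<in>idems. a = e * b"
    using nat_leD star_mult_idem(2) by blast
qed (auto simp: nat_le_left)

lemma nat_le_trans [trans]: "a \<preceq> b \<Longrightarrow> b \<preceq> c \<Longrightarrow> a \<preceq> c"
  unfolding nat_le_iff_right by (auto simp: mult.assoc intro: idem_mult)

lemma nat_le_mult_left: "a \<preceq> b \<Longrightarrow> c * a \<preceq> c * b"
  unfolding nat_le_iff_right by (auto simp: mult.assoc)

lemma nat_le_mult_right: "a \<preceq> b \<Longrightarrow> a * c \<preceq> b * c"
  unfolding nat_le_iff_left by (auto simp: mult.assoc)

lemma nat_le_mult: "a \<preceq> b \<Longrightarrow> c \<preceq> d \<Longrightarrow> a * c \<preceq> b * d"
  by (meson nat_le_mult_left nat_le_mult_right nat_le_trans)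

lemma nat_le_star: "a \<preceq> b \<Longrightarrow> star a \<preceq> star b"
  unfolding nat_le_iff_right[of a] nat_le_iff_left[of "star a"]
  by (auto simp: star_mult star_idem)

lemma nat_le_0D: "a \<preceq> 0 \<Longrightarrow> a = 0"
  by (simp add: nat_le_def)

lemma nat_le_idem: "a \<preceq> e \<Longrightarrow> e \<in> idems \<Longrightarrow> a \<in> idems"
  unfolding nat_le_iff_left by (auto intro: idem_mult)


section \<open>Filters\<close>

lemma in_filter_mult: "x \<in> filter_mult A B \<longleftrightarrow> (\<exists>a\<in>A. \<exists>b\<in>B. a * b \<preceq> x)"
  by (auto simp: filter_mult_def up_in_def set_mult_def)

text \<open>Both bracketings are the upward closure of the triple products: the inner closure is
  absorbed by the outer one because multiplication is monotone.\<close>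

lemma filter_mult_assoc: "filter_mult (filter_mult A B) C = filter_mult A (filter_mult B C)"
proof -
  have "x \<in> filter_mult (filter_mult A B) C \<longleftrightarrow> (\<exists>a\<in>A. \<exists>b\<in>B. \<exists>c\<in>C. a * b * c \<preceq> x)" for x
    unfolding in_filter_mult Bex_def
    by (meson nat_le_mult_right nat_le_trans nat_le_refl)
  moreover have "x \<in> filter_mult A (filter_mult B C) \<longleftrightarrow> (\<exists>a\<in>A. \<exists>b\<in>B. \<exists>c\<in>C. a * b * c \<preceq> x)" for x
    unfolding in_filter_mult Bex_def mult.assoc
    by (meson nat_le_mult_left nat_le_trans nat_le_refl)
  ultimately show ?thesis by blast
qed

lemma in_star_image: "x \<in> star ` A \<longleftrightarrow> star x \<in> (A::'a::inverse_semigroup_zero set)"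
  by (metis (no_types) image_iff star_star)

lemma star_image_star_image [simp]: "star ` star ` A = (A::'a::inverse_semigroup_zero set)"
  by (simp add: image_image)

lemma star_filter_mult:
  fixes A B :: "'a::inverse_semigroup_zero set"
  shows "star ` filter_mult A B = filter_mult (star ` B) (star ` A)"
proof (rule set_eqI)
  fix x :: 'a
  have "a * b \<preceq> star x \<longleftrightarrow> star b * star a \<preceq> x" for a b :: 'a
    using nat_le_star[of "a * b" "star x"] nat_le_star[of "star b * star a" x]
    by (auto simp: star_mult)
  then show "x \<in> star ` filter_mult A B \<longleftrightarrow> x \<in> filter_mult (star ` B) (star ` A)"
    by (auto simp: in_star_image in_filter_mult)
qed

section \<open>Proper filters and their groupoid operations\<close>

lemma proper_filterI:
  assumes "F \<noteq> {}" "F \<subseteq> C" "\<And>a b. a \<in> F \<Longrightarrow> a \<preceq> b \<Longrightarrow> b \<in> C \<Longrightarrow> b \<in> F"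
    "\<And>a b. a \<in> F \<Longrightarrow> b \<in> F \<Longrightarrow> \<exists>c\<in>F. c \<preceq> a \<and> c \<preceq> b" "0 \<notin> F"
  shows "F \<in> proper_filters C"
  using assms nat_le_refl unfolding proper_filters_def filter_in_def up_in_def by blast

lemma proper_filter_up:
  "F \<in> proper_filters C \<Longrightarrow> a \<in> F \<Longrightarrow> a \<preceq> b \<Longrightarrow> b \<in> C \<Longrightarrow> b \<in> F"
  by (auto simp: proper_filters_def filter_in_def up_in_def)

lemma proper_filter_directed:
  "F \<in> proper_filters C \<Longrightarrow> a \<in> F \<Longrightarrow> b \<in> F \<Longrightarrow> \<exists>c\<in>F. c \<preceq> a \<and> c \<preceq> b"
  by (auto simp: proper_filters_def filter_in_def)

lemma proper_filter_nonempty: "F \<in> proper_filters C \<Longrightarrow> \<exists>a. a \<in> F"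
  by (auto simp: proper_filters_def filter_in_def)

lemma proper_filter_subset: "F \<in> proper_filters C \<Longrightarrow> F \<subseteq> C"
  by (auto simp: proper_filters_def filter_in_def)

lemma proper_filter_0: "F \<in> proper_filters C \<Longrightarrow> 0 \<notin> F"
  by (auto simp: proper_filters_def)

lemma star_proper_filter:
  assumes F: "F \<in> proper_filters UNIV"
  shows "star ` F \<in> proper_filters UNIV"
proof (rule proper_filterI)
  show "star ` F \<noteq> {}" using proper_filter_nonempty[OF F] by auto
  show "b \<in> star ` F" if "a \<in> star ` F" "a \<preceq> b" for a b
    using that proper_filter_up[OF F _ nat_le_star] by (auto simp: in_star_image)
  show "\<exists>c\<in>star ` F. c \<preceq> a \<and> c \<preceq> b" if "a \<in> star ` F" "b \<in> star ` F" for a b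
  proof -
    have "star a \<in> F" "star b \<in> F" using that by (auto simp: in_star_image)
    then obtain c where "c \<in> F" "c \<preceq> star a" "c \<preceq> star b"
      using proper_filter_directed[OF F] by blast
    then show ?thesis using nat_le_star[of c "star a"] nat_le_star[of c "star b"] by auto
  qed
  show "0 \<notin> star ` F" using proper_filter_0[OF F] by (simp add: in_star_image)
qed simp

text \<open>Three factors from \<open>F\<close> have a common lower bound \<open>d\<close> in
  \<open>F\<close>, and \<open>d = d * (star d * d)\<close> lies below their product. Conversely
  \<open>x = x * (star x * x)\<close>.\<close>

lemma filter_mult_star_mult:
  assumes F: "F \<in> proper_filters UNIV"
  shows "filter_mult F (filter_mult (star ` F) F) = F"
proof (intro equalityI subsetI)
  fix x assume "x \<in> filter_mult F (filter_mult (star ` F) F)"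
  then obtain a b c y where abc: "a \<in> F" "b \<in> F" "c \<in> F" "star b * c \<preceq> y" "a * y \<preceq> x"
    by (auto simp: in_filter_mult in_star_image)
  obtain d where d: "d \<in> F" "d \<preceq> a" "d \<preceq> b" "d \<preceq> c"
  proof -
    obtain d' where d': "d' \<in> F" "d' \<preceq> a" "d' \<preceq> b"
      using proper_filter_directed[OF F abc(1,2)] by blast
    obtain d where "d \<in> F" "d \<preceq> d'" "d \<preceq> c"
      using proper_filter_directed[OF F d'(1) abc(3)] by blast
    then show ?thesis using that nat_le_trans[OF _ d'(2)] nat_le_trans[OF _ d'(3)] by blast
  qed
  have "d * (star d * d) \<preceq> a * (star b * c)"
    using d by (intro nat_le_mult nat_le_star)
  also have "a * (star b * c) \<preceq> a * y" by (rule nat_le_mult_left) fact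
  also have "a * y \<preceq> x" by fact
  finally show "x \<in> F" using proper_filter_up[OF F d(1)] by simp
next
  fix x assume x: "x \<in> F"
  have "star x * x \<in> filter_mult (star ` F) F"
    unfolding in_filter_mult using x nat_le_refl by blast
  moreover have "x * (star x * x) \<preceq> x" by simp
  ultimately show "x \<in> filter_mult F (filter_mult (star ` F) F)"
    unfolding in_filter_mult[of x] using x by blast
qed

text \<open>The range of \<open>G\<close> acts on \<open>G\<close> from the left, since it is
  absorbed by \<open>G\<close> in the product.\<close>

lemma mult_mem_filter:
  assumes G: "G \<in> proper_filters UNIV" and c: "c \<in> filter_mult G (star ` G)" and b: "b \<in> G"
  shows "c * b \<in> G"
proof -
  have "c * b \<in> filter_mult (filter_mult G (star ` G)) G"
    unfolding in_filter_mult[of _ _ G] using b c nat_le_refl by blast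
  then show ?thesis by (simp add: filter_mult_assoc filter_mult_star_mult[OF G])
qed

text \<open>For \<open>c\<close> in \<open>F\<close>, \<open>star a * c\<close> lies in the source
  of \<open>F\<close>, which is the range of \<open>G\<close> and hence acts on \<open>G\<close>;
  conversely \<open>a * (star a * x)\<close> lies below \<open>x\<close>. One fixed \<open>a\<close>
  thus decides membership in the product, which later yields properness and continuity.\<close>

lemma in_filter_mult_iff:
  assumes F: "F \<in> proper_filters UNIV" and G: "G \<in> proper_filters UNIV"
    and FG: "filter_mult (star ` F) F = filter_mult G (star ` G)" and a: "a \<in> F"
  shows "x \<in> filter_mult F G \<longleftrightarrow> star a * x \<in> G"
proof
  assume "x \<in> filter_mult F G"
  then obtain c b where c: "c \<in> F" "b \<in> G" "c * b \<preceq> x" by (auto simp: in_filter_mult)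
  have "star a * c \<in> filter_mult G (star ` G)"
    unfolding FG[symmetric] in_filter_mult using a c nat_le_refl by blast
  from mult_mem_filter[OF G this \<open>b \<in> G\<close>] have "star a * (c * b) \<in> G"
    by (simp add: mult.assoc)
  then show "star a * x \<in> G"
    using nat_le_mult_left[OF c(3)] proper_filter_up[OF G] by blast
next
  assume *: "star a * x \<in> G"
  have "a * (star a * x) \<preceq> x" using nat_le_left[of "a * star a" x] by (simp add: mult.assoc)
  with * a show "x \<in> filter_mult F G" by (auto simp: in_filter_mult)
qed

lemma filter_mult_proper:
  assumes F: "F \<in> proper_filters UNIV" and G: "G \<in> proper_filters UNIV"
    and FG: "filter_mult (star ` F) F = filter_mult G (star ` G)"
  shows "filter_mult F G \<in> proper_filters UNIV"
proof (rule proper_filterI)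
  obtain a b where ab: "a \<in> F" "b \<in> G" using proper_filter_nonempty[OF F] proper_filter_nonempty[OF G] by blast
  then show "filter_mult F G \<noteq> {}"
    using nat_le_refl[of "a * b"] in_filter_mult by blast
  \<comment> \<open>If \<open>0\<close> were in the product, \<open>star a * 0 = 0\<close> would be
    in \<open>G\<close>.\<close>
  show "0 \<notin> filter_mult F G"
    using in_filter_mult_iff[OF F G FG ab(1), of 0] proper_filter_0[OF G] by simp
  show "y \<in> filter_mult F G" if "x \<in> filter_mult F G" "x \<preceq> y" for x y
    using that unfolding in_filter_mult by (meson nat_le_trans)
  show "\<exists>c\<in>filter_mult F G. c \<preceq> x \<and> c \<preceq> y"
    if xy: "x \<in> filter_mult F G" "y \<in> filter_mult F G" for x y
  proof -
    obtain a b a' b' where 1: "a \<in> F" "b \<in> G" "a * b \<preceq> x" "a' \<in> F" "b' \<in> G" "a' * b' \<preceq> y"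
      using xy by (auto simp: in_filter_mult)
    obtain c d where c: "c \<in> F" "c \<preceq> a" "c \<preceq> a'" and d: "d \<in> G" "d \<preceq> b" "d \<preceq> b'"
      using proper_filter_directed[OF F 1(1,4)] proper_filter_directed[OF G 1(2,5)] by blast
    have "c * d \<in> filter_mult F G" using c d nat_le_refl unfolding in_filter_mult by blast
    moreover have "c * d \<preceq> x" using nat_le_trans[OF nat_le_mult[OF c(2) d(2)] 1(3)] .
    moreover have "c * d \<preceq> y" using nat_le_trans[OF nat_le_mult[OF c(3) d(3)] 1(6)] .
    ultimately show ?thesis by blast
  qed
qed simp

lemma is_groupoid_filter_groupoid: "is_groupoid (filter_groupoid :: 'a::inverse_semigroup_zero set groupoid)"
proof -
  \<comment> \<open>The inner source of \<open>F\<close> is replaced by the range of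
    \<open>G\<close>, which \<open>G\<close> then absorbs.\<close>
  have src: "filter_mult (star ` filter_mult F G) (filter_mult F G) = filter_mult (star ` G) G"
    if "F \<in> proper_filters UNIV" "G \<in> proper_filters UNIV"
      "filter_mult (star ` F) F = filter_mult G (star ` G)" for F G :: "'a set"
  proof -
    have "filter_mult (star ` filter_mult F G) (filter_mult F G)
        = filter_mult (star ` G) (filter_mult (filter_mult (star ` F) F) G)"
      by (simp add: star_filter_mult filter_mult_assoc)
    then show ?thesis by (simp add: that filter_mult_assoc filter_mult_star_mult)
  qed
  \<comment> \<open>The range of a product is the source of its inverse, so this is
    \<open>src\<close> for the starred pair in reverse order.\<close>
  have rng: "filter_mult (filter_mult F G) (star ` filter_mult F G) = filter_mult F (star ` F)"
    if "F \<in> proper_filters UNIV" "G \<in> proper_filters UNIV"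
      "filter_mult (star ` F) F = filter_mult G (star ` G)" for F G :: "'a set"
    using src[of "star ` G" "star ` F"] that
    by (simp add: star_filter_mult star_proper_filter)
  have inv1: "filter_mult (star ` F) (filter_mult F G) = G"
    if "F \<in> proper_filters UNIV" "G \<in> proper_filters UNIV"
      "filter_mult (star ` F) F = filter_mult G (star ` G)" for F G :: "'a set"
    using that by (simp add: filter_mult_assoc[symmetric])
      (simp add: filter_mult_assoc filter_mult_star_mult)
  have inv2: "filter_mult (filter_mult F G) (star ` G) = F"
    if "F \<in> proper_filters UNIV" "G \<in> proper_filters UNIV"
      "filter_mult (star ` F) F = filter_mult G (star ` G)" for F G :: "'a set"
    using that by (simp add: filter_mult_assoc that(3)[symmetric] filter_mult_star_mult)
  show ?thesis
    unfolding is_groupoid_def filter_groupoid_def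
    by (auto simp: filter_mult_proper star_proper_filter src rng inv1 inv2)
      (simp_all add: filter_mult_assoc)
qed


section \<open>The idempotents of the source\<close>

text \<open>Multiplying \<open>s\<close> by an element of the source stays in \<open>F\<close>, and
  conversely \<open>star s * (s * e)\<close> lies below \<open>e\<close>. Membership in the source
  is thereby tested by a single element of \<open>F\<close>, any one of which will do.\<close>

lemma in_idem_source:
  assumes F: "F \<in> proper_filters UNIV" and s: "s \<in> F"
  shows "e \<in> idem_source F \<longleftrightarrow> e \<in> idems \<and> s * e \<in> F"
proof
  assume "e \<in> idem_source F"
  then have e: "e \<in> idems" "e \<in> filter_mult (star ` F) F"
    by (auto simp: idem_source_def filter_source_def)
  have "s * e \<in> filter_mult F (filter_mult (star ` F) F)"
    using s e nat_le_refl unfolding in_filter_mult[of _ F] by blast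
  with e show "e \<in> idems \<and> s * e \<in> F" by (simp add: filter_mult_star_mult[OF F])
next
  assume e: "e \<in> idems \<and> s * e \<in> F"
  have "star s * (s * e) \<preceq> e" using nat_le_left[of "star s * s" e] by (simp add: mult.assoc)
  then show "e \<in> idem_source F"
    using e s by (auto simp: idem_source_def filter_source_def in_filter_mult)
qed

lemma star_mult_mem_idem_source:
  assumes "F \<in> proper_filters UNIV" "s \<in> F"
  shows "star s * s \<in> idem_source F"
  using assms by (simp add: in_idem_source)

lemma idem_source_proper:
  assumes F: "F \<in> proper_filters UNIV"
  shows "idem_source F \<in> proper_filters idems"
proof -
  obtain s where s: "s \<in> F" using proper_filter_nonempty[OF F] by blast
  note src = in_idem_source[OF F s]
  show ?thesis
  proof (rule proper_filterI)
    show "idem_source F \<noteq> {}" using star_mult_mem_idem_source[OF F s] by blast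
    show "idem_source F \<subseteq> idems" using src by blast
    show "b \<in> idem_source F" if "a \<in> idem_source F" "a \<preceq> b" "b \<in> idems" for a b
      using that src nat_le_mult_left proper_filter_up[OF F] by blast
    show "0 \<notin> idem_source F" using proper_filter_0[OF F] src by simp
    show "\<exists>c\<in>idem_source F. c \<preceq> a \<and> c \<preceq> b"
      if "a \<in> idem_source F" "b \<in> idem_source F" for a b
    proof -
      \<comment> \<open>The freedom in the test element is used: testing \<open>b\<close> against
        \<open>s * a\<close> instead of \<open>s\<close> puts \<open>s * a * b\<close> in
        \<open>F\<close>, hence \<open>a * b\<close> in the source.\<close>
      have "s * a \<in> F" "a \<in> idems" "b \<in> idems" using that src by auto
      with that have "a * b \<in> idem_source F"
        using in_idem_source[OF F \<open>s * a \<in> F\<close>, of b] src by (simp add: idem_mult mult.assoc)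
      with \<open>a \<in> idems\<close> \<open>b \<in> idems\<close> show ?thesis using nat_le_left nat_le_right by blast
    qed
  qed
qed

text \<open>Given \<open>x\<close> in \<open>F\<close>, a common lower bound \<open>c\<close> of
  \<open>x\<close> and \<open>s\<close> in \<open>F\<close> has the form
  \<open>s * (star c * c)\<close>, and \<open>star c * c\<close> is a source idempotent. This gives
  both injectivity and the formula for the inverse map.\<close>

lemma filter_eq_up:
  assumes F: "F \<in> proper_filters UNIV" and s: "s \<in> F"
  shows "F = up_in UNIV (set_mult {s} (idem_source F))"
proof (rule set_eqI)
  fix x
  have "x \<in> F \<longleftrightarrow> (\<exists>e\<in>idem_source F. s * e \<preceq> x)"
  proof
    assume "x \<in> F"
    then obtain c where c: "c \<in> F" "c \<preceq> x" "c \<preceq> s"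
      using proper_filter_directed[OF F _ s] by blast
    with nat_leD_right[OF c(3)] star_mult_mem_idem_source[OF F c(1)]
    show "\<exists>e\<in>idem_source F. s * e \<preceq> x" by metis
  qed (use in_idem_source[OF F s] proper_filter_up[OF F] in blast)
  then show "x \<in> F \<longleftrightarrow> x \<in> up_in UNIV (set_mult {s} (idem_source F))"
    by (auto simp: up_in_def set_mult_def)
qed

text \<open>A product \<open>star a * b\<close> of elements of \<open>F\<close> lies above
  \<open>star c * c\<close> for any \<open>c\<close> in \<open>F\<close> below both, so the source
  is determined by its idempotents.\<close>

lemma filter_source_eq_up:
  assumes F: "F \<in> proper_filters UNIV"
  shows "filter_source F = up_in UNIV (idem_source F)"
proof (intro equalityI subsetI)
  fix x assume "x \<in> filter_source F"
  then obtain a b where ab: "a \<in> F" "b \<in> F" "star a * b \<preceq> x"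
    by (auto simp: filter_source_def in_filter_mult)
  then obtain c where c: "c \<in> F" "c \<preceq> a" "c \<preceq> b"
    using proper_filter_directed[OF F] by blast
  then have "star c * c \<preceq> x" using ab by (meson nat_le_mult nat_le_star nat_le_trans)
  with star_mult_mem_idem_source[OF F c(1)] show "x \<in> up_in UNIV (idem_source F)"
    by (auto simp: up_in_def)
next
  fix x assume "x \<in> up_in UNIV (idem_source F)"
  then obtain e where "e \<in> filter_source F" "e \<preceq> x"
    by (auto simp: up_in_def idem_source_def)
  then show "x \<in> filter_source F"
    unfolding filter_source_def in_filter_mult by (meson nat_le_trans)
qed

lemma filter_source_eq_iff:
  assumes "F \<in> proper_filters UNIV" "G \<in> proper_filters UNIV"
  shows "filter_source F = filter_source G \<longleftrightarrow> idem_source F = idem_source G"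
  using assms filter_source_eq_up by (metis idem_source_def)

text \<open>The range of \<open>G\<close> is the source of its star, and sources may be compared on
  idempotents. This is the form that matches composability of germs.\<close>

lemma composable_filter_iff:
  "(F, G) \<in> composable filter_groupoid \<longleftrightarrow>
    F \<in> proper_filters UNIV \<and> G \<in> proper_filters UNIV \<and> idem_source F = idem_source (star ` G)"
proof -
  have "filter_mult (star ` F) F = filter_mult G (star ` G) \<longleftrightarrow>
      filter_source F = filter_source (star ` G)"
    by (simp add: filter_source_def)
  then show ?thesis
    using filter_source_eq_iff[of F "star ` G"] star_proper_filter[of G]
    by (auto simp: filter_groupoid_def)
qed

lemma idem_source_filter_mult:
  assumes "(F, G) \<in> composable filter_groupoid"
  shows "idem_source (filter_mult F G) = idem_source G"
proof -
  have FG: "F \<in> proper_filters UNIV" "G \<in> proper_filters UNIV"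
      "filter_mult (star ` F) F = filter_mult G (star ` G)"
    using assms by (auto simp: filter_groupoid_def)
  have "filter_source (filter_mult F G)
      = filter_mult (star ` G) (filter_mult (filter_mult (star ` F) F) G)"
    by (simp add: filter_source_def star_filter_mult filter_mult_assoc)
  then show ?thesis
    by (simp add: idem_source_def filter_source_def FG filter_mult_assoc filter_mult_star_mult)
qed

text \<open>The action on idempotent filters sends the source part of \<open>F\<close> to its range
  part, which links the two notions of composability and of inverse.\<close>

lemma germ_action_idem_source:
  assumes F: "F \<in> proper_filters UNIV" and s: "s \<in> F"
  shows "germ_action s (idem_source F) = idem_source (star ` F)"
proof (intro equalityI subsetI)
  fix f assume "f \<in> germ_action s (idem_source F)"
  then obtain e where f: "f \<in> idems" and e: "e \<in> idem_source F" "s * e * star s \<preceq> f"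
    by (auto simp: germ_action_def)
  have "s * e \<in> F" using e in_idem_source[OF F s] by blast
  then have "f \<in> filter_mult F (star ` F)" using s e by (auto simp: in_filter_mult)
  with f show "f \<in> idem_source (star ` F)" by (simp add: idem_source_def filter_source_def)
next
  fix f assume "f \<in> idem_source (star ` F)"
  then have f: "f \<in> idems" "f \<in> filter_mult F (star ` F)"
    by (auto simp: idem_source_def filter_source_def)
  have "f * s \<in> F" using mult_mem_filter[OF F f(2) s] .
  \<comment> \<open>Since \<open>f * s\<close> lies below \<open>s\<close>, it equals
    \<open>s\<close> times its own source idempotent; so \<open>e\<close> satisfies
    \<open>s * e = f * s\<close>, and \<open>s * e * star s\<close> lies below
    \<open>f\<close>.\<close>
  define e where "e = star (f * s) * (f * s)"
  have "e \<in> idem_source F" using star_mult_mem_idem_source[OF F \<open>f * s \<in> F\<close>] by (simp add: e_def)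
  moreover have "s * e = f * s"
    using nat_leD_right[OF nat_le_left[OF f(1), of s]] by (simp add: e_def)
  then have "s * e * star s \<preceq> f"
    using nat_le_right[of "s * star s" f] by (simp add: mult.assoc)
  ultimately show "f \<in> germ_action s (idem_source F)" using f by (auto simp: germ_action_def)
qed


section \<open>Germs\<close>

lemma in_germ_pairs: "(s, \<xi>) \<in> germ_pairs \<longleftrightarrow> \<xi> \<in> proper_filters idems \<and> star s * s \<in> \<xi>"
  by (simp add: germ_pairs_def idem_filters_at_def)

lemma proper_filter_idem_mult:
  assumes \<xi>: "\<xi> \<in> proper_filters idems" and ef: "e \<in> \<xi>" "f \<in> \<xi>"
  shows "e * f \<in> \<xi>"
proof -
  have i: "e \<in> idems" "f \<in> idems" using proper_filter_subset[OF \<xi>] ef by auto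
  obtain g where g: "g \<in> \<xi>" "g \<preceq> e" "g \<preceq> f"
    using proper_filter_directed[OF \<xi> ef] by blast
  then have "g \<in> idems" using proper_filter_subset[OF \<xi>] by auto
  with nat_le_mult[OF g(2,3)] have "g \<preceq> e * f" by (simp add: idemsD)
  then show ?thesis using proper_filter_up[OF \<xi> g(1)] idem_mult[OF i] by blast
qed

text \<open>For transitivity the product of the two witnesses works: they commute, so either of the
  given equations can be applied to it.\<close>

lemma equiv_germ_rel:
  "equiv germ_pairs (germ_rel :: (('a::inverse_semigroup_zero \<times> 'a set) \<times> _) set)"
  (is "equiv ?P ?R")
proof (rule equivI)
  show "?R \<subseteq> ?P \<times> ?P" by (auto simp: germ_rel_def)
  show "refl_on ?P ?R"
    by (rule refl_onI) (auto simp: germ_rel_def in_germ_pairs)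
  show "sym ?R"
  proof (rule symI)
    fix p q :: "'a \<times> 'a set"
    assume "(p, q) \<in> germ_rel"
    then obtain s t \<xi> e where *: "p = (s, \<xi>)" "q = (t, \<xi>)"
      "(s, \<xi>) \<in> germ_pairs" "(t, \<xi>) \<in> germ_pairs" "e \<in> \<xi>" "s * e = t * e"
      by (auto simp: germ_rel_def)
    from *(6)[symmetric] *(5) have "\<exists>e\<in>\<xi>. t * e = s * e" by (rule bexI)
    with * show "(q, p) \<in> germ_rel" by (simp add: germ_rel_def)
  qed
  show "trans ?R"
  proof (rule transI)
    fix p q r :: "'a \<times> 'a set"
    assume "(p, q) \<in> germ_rel" "(q, r) \<in> germ_rel"
    then obtain s t u \<xi> e f where *: "p = (s, \<xi>)" "r = (u, \<xi>)"
        "(s, \<xi>) \<in> germ_pairs" "(u, \<xi>) \<in> germ_pairs"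
      and ef: "e \<in> \<xi>" "f \<in> \<xi>" "s * e = t * e" "t * f = u * f"
      by (auto simp: germ_rel_def)
    have \<xi>: "\<xi> \<in> proper_filters idems" using * by (simp add: in_germ_pairs)
    have comm: "e * f = f * e"
      by (rule idem_commute) (use proper_filter_subset[OF \<xi>] ef in auto)
    have "s * (e * f) = (t * e) * f" by (simp only: ef(3) mult.assoc[symmetric])
    also have "\<dots> = t * (f * e)" by (simp only: mult.assoc comm)
    also have "\<dots> = (u * f) * e" by (simp only: ef(4) mult.assoc[symmetric])
    also have "\<dots> = u * (e * f)" by (simp only: mult.assoc comm)
    finally have "\<exists>e\<in>\<xi>. s * e = u * e" using proper_filter_idem_mult[OF \<xi> ef(1,2)] by blast
    then show "(p, r) \<in> germ_rel" using * by (simp add: germ_rel_def)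
  qed
qed

lemma germ_eq_iff:
  assumes "(s, \<xi>) \<in> germ_pairs" "(t, \<eta>) \<in> germ_pairs"
  shows "germ s \<xi> = germ t \<eta> \<longleftrightarrow> \<xi> = \<eta> \<and> (\<exists>e\<in>\<xi>. s * e = t * e)"
  unfolding germ_def using eq_equiv_class_iff[OF equiv_germ_rel assms] assms
  by (simp add: germ_rel_def)

lemma germ_pairs_idem_source:
  assumes "F \<in> proper_filters UNIV" "s \<in> F"
  shows "(s, idem_source F) \<in> germ_pairs"
  using assms by (simp add: in_germ_pairs idem_source_proper star_mult_mem_idem_source)

text \<open>If \<open>s * e = t * e\<close> with \<open>e\<close> in the source, this element is in
  \<open>F\<close> and below \<open>t\<close>. Conversely a lower bound \<open>c\<close> of
  \<open>s\<close> and \<open>t\<close> in \<open>F\<close> gives the witness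
  \<open>star c * c\<close>, as \<open>c\<close> is the restriction of both to it.\<close>

lemma germ_idem_source_eq_iff:
  assumes F: "F \<in> proper_filters UNIV" and s: "s \<in> F" and t: "(t, \<eta>) \<in> germ_pairs"
  shows "germ s (idem_source F) = germ t \<eta> \<longleftrightarrow> t \<in> F \<and> \<eta> = idem_source F"
proof
  assume "germ s (idem_source F) = germ t \<eta>"
  then obtain e where e: "e \<in> idem_source F" "s * e = t * e" and \<eta>: "\<eta> = idem_source F"
    unfolding germ_eq_iff[OF germ_pairs_idem_source[OF F s] t] by blast
  have "t * e \<in> F" "e \<in> idems" using e in_idem_source[OF F s, of e] by auto
  then show "t \<in> F \<and> \<eta> = idem_source F"
    using \<eta> proper_filter_up[OF F _ nat_le_right] by blast
next
  assume *: "t \<in> F \<and> \<eta> = idem_source F"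
  then obtain c where c: "c \<in> F" "c \<preceq> s" "c \<preceq> t"
    using proper_filter_directed[OF F s] by blast
  have "s * (star c * c) = t * (star c * c)"
    by (rule trans[OF nat_leD_right[OF c(2), symmetric] nat_leD_right[OF c(3)]])
  then show "germ s (idem_source F) = germ t \<eta>"
    unfolding germ_eq_iff[OF germ_pairs_idem_source[OF F s] t]
    using * star_mult_mem_idem_source[OF F c(1)] by blast
qed

text \<open>Removes the choice hidden in \<open>filter_to_germ\<close>; bijectivity, the operations
  and the preimages of basic open sets are all read off from this equivalence.\<close>

lemma filter_to_germ_eq_iff:
  assumes F: "F \<in> proper_filters UNIV" and t: "(t, \<eta>) \<in> germ_pairs"
  shows "filter_to_germ F = germ t \<eta> \<longleftrightarrow> t \<in> F \<and> \<eta> = idem_source F"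
  unfolding filter_to_germ_def
  using germ_idem_source_eq_iff[OF F someI_ex[OF proper_filter_nonempty[OF F]] t] .

lemma filter_to_germ_eq:
  assumes "F \<in> proper_filters UNIV" "s \<in> F"
  shows "filter_to_germ F = germ s (idem_source F)"
  using assms by (simp add: filter_to_germ_eq_iff germ_pairs_idem_source)

section \<open>From germs back to filters, and bijectivity\<close>

lemma in_up_set_mult: "x \<in> up_in UNIV (set_mult {s} \<xi>) \<longleftrightarrow> (\<exists>e\<in>\<xi>. s * e \<preceq> x)"
  by (auto simp: up_in_def set_mult_def)

lemma up_set_mult_mem:
  assumes "(s, \<xi>) \<in> germ_pairs"
  shows "s \<in> up_in UNIV (set_mult {s} \<xi>)"
proof -
  have "s * (star s * s) \<preceq> s" by simp
  then show ?thesis using assms unfolding in_germ_pairs in_up_set_mult by blast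
qed

lemma up_set_mult_proper:
  assumes "(s, \<xi>) \<in> germ_pairs"
  shows "up_in UNIV (set_mult {s} \<xi>) \<in> proper_filters UNIV" (is "?F \<in> _")
proof (rule proper_filterI)
  have \<xi>: "\<xi> \<in> proper_filters idems" and s: "star s * s \<in> \<xi>"
    using assms by (auto simp: in_germ_pairs)
  show "?F \<noteq> {}" using up_set_mult_mem[OF assms] by blast
  show "b \<in> ?F" if "a \<in> ?F" "a \<preceq> b" for a b
    using that unfolding in_up_set_mult by (meson nat_le_trans)
  show "0 \<notin> ?F"
  proof
    assume "0 \<in> ?F"
    then obtain e where e: "e \<in> \<xi>" "s * e = 0" by (auto simp: in_up_set_mult dest: nat_le_0D)
    \<comment> \<open>This is where the germ pair condition enters: \<open>s * e = 0\<close> would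
      force \<open>0\<close> into the proper filter \<open>\<xi>\<close>.\<close>
    have "star s * s * e \<in> \<xi>" by (rule proper_filter_idem_mult[OF \<xi> s e(1)])
    with e show False using proper_filter_0[OF \<xi>] by (simp add: mult.assoc)
  qed
  show "\<exists>c\<in>?F. c \<preceq> a \<and> c \<preceq> b" if ab: "a \<in> ?F" "b \<in> ?F" for a b
  proof -
    obtain e f where e: "e \<in> \<xi>" "s * e \<preceq> a" and f: "f \<in> \<xi>" "s * f \<preceq> b"
      using ab by (auto simp: in_up_set_mult)
    obtain g where g: "g \<in> \<xi>" "g \<preceq> e" "g \<preceq> f"
      using proper_filter_directed[OF \<xi> e(1) f(1)] by blast
    have "s * g \<preceq> a" using nat_le_trans[OF nat_le_mult_left[OF g(2)] e(2)] .
    moreover have "s * g \<preceq> b" using nat_le_trans[OF nat_le_mult_left[OF g(3)] f(2)] .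
    moreover have "s * g \<in> ?F" unfolding in_up_set_mult using g(1) nat_le_refl by blast
    ultimately show ?thesis by blast
  qed
qed simp

text \<open>By \<open>in_idem_source\<close>, \<open>f\<close> is in the source iff
  \<open>s * f\<close> lies above some \<open>s * e\<close> with \<open>e\<close> in
  \<open>\<xi>\<close>. Multiplying by \<open>star s\<close> then puts an element of
  \<open>\<xi>\<close> below \<open>f\<close>.\<close>

lemma idem_source_up_set_mult:
  assumes "(s, \<xi>) \<in> germ_pairs"
  shows "idem_source (up_in UNIV (set_mult {s} \<xi>)) = \<xi>"
proof (rule set_eqI)
  fix f
  have \<xi>: "\<xi> \<in> proper_filters idems" and s: "star s * s \<in> \<xi>"
    using assms by (auto simp: in_germ_pairs)
  have "f \<in> idems \<and> (\<exists>e\<in>\<xi>. s * e \<preceq> s * f) \<longleftrightarrow> f \<in> \<xi>"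
  proof
    assume *: "f \<in> idems \<and> (\<exists>e\<in>\<xi>. s * e \<preceq> s * f)"
    then obtain e where e: "e \<in> \<xi>" "s * e \<preceq> s * f" by blast
    have "star s * s * e \<preceq> star s * s * f"
      using nat_le_mult_left[OF e(2), of "star s"] by (simp add: mult.assoc)
    also have "star s * s * f \<preceq> f" by (simp add: nat_le_left)
    finally show "f \<in> \<xi>"
      using proper_filter_up[OF \<xi> proper_filter_idem_mult[OF \<xi> s e(1)]] * by blast
  qed (use proper_filter_subset[OF \<xi>] nat_le_refl in blast)
  then show "f \<in> idem_source (up_in UNIV (set_mult {s} \<xi>)) \<longleftrightarrow> f \<in> \<xi>"
    using in_idem_source[OF up_set_mult_proper[OF assms] up_set_mult_mem[OF assms]]
    by (simp add: in_up_set_mult)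
qed

lemma filter_to_germ_up_set_mult:
  assumes "(s, \<xi>) \<in> germ_pairs"
  shows "filter_to_germ (up_in UNIV (set_mult {s} \<xi>)) = germ s \<xi>"
  using assms
  by (simp add: filter_to_germ_eq_iff up_set_mult_proper up_set_mult_mem idem_source_up_set_mult)

lemma arrows_germ_groupoid: "arrows germ_groupoid = {germ s \<xi> | s \<xi>. (s, \<xi>) \<in> germ_pairs}"
  by (auto simp: germ_groupoid_def quotient_def germ_def)

text \<open>Equal germs force a common element \<open>s\<close> and equal source idempotents, and
  \<open>filter_eq_up\<close> rebuilds each filter from these data.\<close>

lemma filter_to_germ_inject:
  assumes F: "F \<in> proper_filters UNIV" and G: "G \<in> proper_filters UNIV"
    and eq: "filter_to_germ F = filter_to_germ G"
  shows "F = G"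
proof -
  obtain s where s: "s \<in> G" using proper_filter_nonempty[OF G] by blast
  have "s \<in> F" "idem_source G = idem_source F"
    using eq filter_to_germ_eq_iff[OF F germ_pairs_idem_source[OF G s]]
    by (auto simp: filter_to_germ_eq[OF G s])
  then show ?thesis using filter_eq_up[OF F] filter_eq_up[OF G s] by metis
qed

lemma bij_betw_filter_to_germ:
  "bij_betw filter_to_germ (proper_filters UNIV) (arrows germ_groupoid)"
proof (rule bij_betw_imageI)
  show "inj_on filter_to_germ (proper_filters UNIV)"
    by (intro inj_onI filter_to_germ_inject)
  have "\<exists>s \<xi>. filter_to_germ F = germ s \<xi> \<and> (s, \<xi>) \<in> germ_pairs"
    if F: "F \<in> proper_filters UNIV" for F :: "'a set"
    using proper_filter_nonempty[OF F] filter_to_germ_eq[OF F] germ_pairs_idem_source[OF F] by blast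
  then show "filter_to_germ ` proper_filters UNIV = arrows (germ_groupoid :: ('a \<times> 'a set) set groupoid)"
    unfolding arrows_germ_groupoid
    using filter_to_germ_up_set_mult[symmetric] up_set_mult_proper by blast
qed

lemma inv_filter_to_germ:
  assumes "(s, \<xi>) \<in> germ_pairs"
  shows "inv_into (proper_filters UNIV) filter_to_germ (germ s \<xi>) = up_in UNIV (set_mult {s} \<xi>)"
  using assms bij_betw_filter_to_germ
  by (intro inv_into_f_eq) (auto simp: bij_betw_def filter_to_germ_up_set_mult up_set_mult_proper)

section \<open>Germ operations as images of the filter operations\<close>

lemma germ_pairs_filter:
  assumes "(s, \<xi>) \<in> germ_pairs"
  obtains F where "F \<in> proper_filters UNIV" "s \<in> F" "\<xi> = idem_source F"
  using that[OF up_set_mult_proper[OF assms] up_set_mult_mem[OF assms]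
      idem_source_up_set_mult[OF assms, symmetric]] .

text \<open>Realising both germs by filters \<open>F\<close> and \<open>G\<close>, the condition on
  the action of \<open>t\<close> says that the source idempotents of \<open>F\<close> are the range
  idempotents of \<open>G\<close>.\<close>

lemma composable_germ_groupoid:
  "composable germ_groupoid = map_prod filter_to_germ filter_to_germ ` composable filter_groupoid"
proof (intro equalityI subsetI)
  fix p :: "('a \<times> 'a set) set \<times> ('a \<times> 'a set) set"
  assume "p \<in> composable germ_groupoid"
  then obtain s t \<eta> where p: "p = (germ s (germ_action t \<eta>), germ t \<eta>)"
    and st: "(s, germ_action t \<eta>) \<in> germ_pairs" "(t, \<eta>) \<in> germ_pairs"
    by (auto simp: germ_groupoid_def)
  obtain G where G: "G \<in> proper_filters UNIV" "t \<in> G" "\<eta> = idem_source G"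
    using germ_pairs_filter[OF st(2)] .
  obtain F where F: "F \<in> proper_filters UNIV" "s \<in> F" "germ_action t \<eta> = idem_source F"
    using germ_pairs_filter[OF st(1)] .
  have "(F, G) \<in> composable filter_groupoid"
    using F G germ_action_idem_source[OF G(1,2)] by (simp add: composable_filter_iff)
  moreover have "p = map_prod filter_to_germ filter_to_germ (F, G)"
    using F G p by (simp add: filter_to_germ_eq)
  ultimately show "p \<in> map_prod filter_to_germ filter_to_germ ` composable filter_groupoid" by blast
next
  fix p :: "('a \<times> 'a set) set \<times> ('a \<times> 'a set) set"
  assume "p \<in> map_prod filter_to_germ filter_to_germ ` composable filter_groupoid"
  then obtain F G where p: "p = (filter_to_germ F, filter_to_germ G)"
    and FG: "F \<in> proper_filters UNIV" "G \<in> proper_filters UNIV"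
      "idem_source F = idem_source (star ` G)"
    by (auto simp: composable_filter_iff)
  obtain s t where st: "s \<in> F" "t \<in> G" using proper_filter_nonempty[OF FG(1)] proper_filter_nonempty[OF FG(2)] by blast
  have "germ_action t (idem_source G) = idem_source F"
    using germ_action_idem_source[OF FG(2) st(2)] FG(3) by simp
  then have "\<exists>s \<xi> t \<eta>. p = (germ s \<xi>, germ t \<eta>) \<and>
      (s, \<xi>) \<in> germ_pairs \<and> (t, \<eta>) \<in> germ_pairs \<and> \<xi> = germ_action t \<eta>"
    using p filter_to_germ_eq[OF FG(1) st(1)] filter_to_germ_eq[OF FG(2) st(2)]
      germ_pairs_idem_source[OF FG(1) st(1)] germ_pairs_idem_source[OF FG(2) st(2)] by blast
  then show "p \<in> composable germ_groupoid"
    by (simp add: germ_groupoid_def)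
qed

text \<open>Evaluates the definite description: any admissible representatives satisfy
  \<open>s \<in> F\<close> and \<open>t \<in> G\<close>, so \<open>s * t\<close> lies in the product
  filter, whose source idempotents are those of \<open>G\<close>. The germ is then the same for all
  choices.\<close>

lemma gmult_filter_to_germ:
  assumes FG: "(F, G) \<in> composable filter_groupoid"
  shows "gmult germ_groupoid (filter_to_germ F) (filter_to_germ G) = filter_to_germ (filter_mult F G)"
proof -
  have F: "F \<in> proper_filters UNIV" and G: "G \<in> proper_filters UNIV"
    and comp: "idem_source F = idem_source (star ` G)"
    using FG by (auto simp: composable_filter_iff)
  have H: "filter_mult F G \<in> proper_filters UNIV"
    using FG filter_mult_proper by (auto simp: filter_groupoid_def)
  have prod: "germ (s * t) (idem_source G) = filter_to_germ (filter_mult F G)"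
    if "s \<in> F" "t \<in> G" for s t
  proof -
    have "s * t \<in> filter_mult F G" using that nat_le_refl unfolding in_filter_mult by blast
    from filter_to_germ_eq[OF H this] show ?thesis by (simp add: idem_source_filter_mult[OF FG])
  qed
  obtain s t where st: "s \<in> F" "t \<in> G" using proper_filter_nonempty[OF F] proper_filter_nonempty[OF G] by blast
  have act: "germ_action t (idem_source G) = idem_source F"
    using germ_action_idem_source[OF G st(2)] comp by simp
  show ?thesis unfolding germ_groupoid_def groupoid.simps
  proof (rule the_equality)
    show "\<exists>s t \<eta>. (s, germ_action t \<eta>) \<in> germ_pairs \<and> (t, \<eta>) \<in> germ_pairs \<and>
        filter_to_germ F = germ s (germ_action t \<eta>) \<and> filter_to_germ G = germ t \<eta> \<and>
        filter_to_germ (filter_mult F G) = germ (s * t) \<eta>"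
      using filter_to_germ_eq[OF F st(1)] filter_to_germ_eq[OF G st(2)] prod[OF st]
        germ_pairs_idem_source[OF F st(1)] germ_pairs_idem_source[OF G st(2)]
      by (intro exI[of _ s] exI[of _ t] exI[of _ "idem_source G"]) (simp add: act)
    fix \<gamma> assume "\<exists>s t \<eta>. (s, germ_action t \<eta>) \<in> germ_pairs \<and> (t, \<eta>) \<in> germ_pairs \<and>
        filter_to_germ F = germ s (germ_action t \<eta>) \<and> filter_to_germ G = germ t \<eta> \<and>
        \<gamma> = germ (s * t) \<eta>"
    then obtain s t \<eta> where st: "(s, germ_action t \<eta>) \<in> germ_pairs" "(t, \<eta>) \<in> germ_pairs"
      and eq: "filter_to_germ F = germ s (germ_action t \<eta>)" "filter_to_germ G = germ t \<eta>"
      and \<gamma>: "\<gamma> = germ (s * t) \<eta>" by blast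
    have "s \<in> F" "t \<in> G" "\<eta> = idem_source G"
      using eq unfolding filter_to_germ_eq_iff[OF F st(1)] filter_to_germ_eq_iff[OF G st(2)] by auto
    then show "\<gamma> = filter_to_germ (filter_mult F G)" using prod \<gamma> by simp
  qed
qed

lemma ginv_filter_to_germ:
  assumes F: "F \<in> proper_filters UNIV"
  shows "ginv germ_groupoid (filter_to_germ F) = filter_to_germ (star ` F)"
proof -
  have inv: "germ (star s) (germ_action s (idem_source F)) = filter_to_germ (star ` F)"
    if "s \<in> F" for s
    using that filter_to_germ_eq[OF star_proper_filter[OF F], of "star s"]
    by (simp add: germ_action_idem_source[OF F])
  obtain s where s: "s \<in> F" using proper_filter_nonempty[OF F] by blast
  show ?thesis unfolding germ_groupoid_def groupoid.simps
  proof (rule the_equality)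
    show "\<exists>s \<xi>. (s, \<xi>) \<in> germ_pairs \<and> filter_to_germ F = germ s \<xi> \<and>
        filter_to_germ (star ` F) = germ (star s) (germ_action s \<xi>)"
      using filter_to_germ_eq[OF F s] inv[OF s] germ_pairs_idem_source[OF F s]
      by (intro exI[of _ s] exI[of _ "idem_source F"]) simp
    fix \<gamma> assume "\<exists>s \<xi>. (s, \<xi>) \<in> germ_pairs \<and> filter_to_germ F = germ s \<xi> \<and>
        \<gamma> = germ (star s) (germ_action s \<xi>)"
    then obtain s \<xi> where s: "(s, \<xi>) \<in> germ_pairs" and eq: "filter_to_germ F = germ s \<xi>"
      and \<gamma>: "\<gamma> = germ (star s) (germ_action s \<xi>)" by blast
    have "s \<in> F" "\<xi> = idem_source F"
      using eq unfolding filter_to_germ_eq_iff[OF F s] by auto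
    then show "\<gamma> = filter_to_germ (star ` F)" using inv \<gamma> by simp
  qed
qed


section \<open>Transport of topological groupoids\<close>

text \<open>Spares verifying the groupoid laws on representatives of germs: each law pulls back
  along the injective \<open>\<phi>\<close>.\<close>

lemma is_groupoid_transport:
  assumes G: "is_groupoid G" and bij: "bij_betw \<phi> (arrows G) (arrows H)"
    and comp: "composable H = map_prod \<phi> \<phi> ` composable G"
    and mult: "\<And>a b. (a, b) \<in> composable G \<Longrightarrow> gmult H (\<phi> a) (\<phi> b) = \<phi> (gmult G a b)"
    and inv: "\<And>a. a \<in> arrows G \<Longrightarrow> ginv H (\<phi> a) = \<phi> (ginv G a)"
  shows "is_groupoid H"
proof -
  have sub: "a \<in> arrows G" "b \<in> arrows G" "gmult G a b \<in> arrows G"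
    and cancel: "gmult G (ginv G a) (gmult G a b) = b" "gmult G (gmult G a b) (ginv G b) = a"
    if "(a, b) \<in> composable G" for a b
    using G that unfolding is_groupoid_def by auto
  have invG: "ginv G a \<in> arrows G" "ginv G (ginv G a) = a" "(ginv G a, a) \<in> composable G"
    if "a \<in> arrows G" for a
    using G that unfolding is_groupoid_def by auto
  have assoc: "(gmult G a b, c) \<in> composable G" "(a, gmult G b c) \<in> composable G"
      "gmult G (gmult G a b) c = gmult G a (gmult G b c)"
    if "(a, b) \<in> composable G" "(b, c) \<in> composable G" for a b c
    using G that unfolding is_groupoid_def by blast+
  have inj: "a = b" if "\<phi> a = \<phi> b" "a \<in> arrows G" "b \<in> arrows G" for a b
    using bij that by (auto simp: bij_betw_def inj_on_def)
  have img: "arrows H = \<phi> ` arrows G" using bij by (simp add: bij_betw_def)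
  have compI: "(\<phi> a, \<phi> b) \<in> composable H" if "(a, b) \<in> composable G" for a b
    using that unfolding comp by force
  \<comment> \<open>The cancellation laws contain nested products; \<open>mult\<close> applies to
    the outer one only once that pair is known to be composable in \<open>G\<close>.\<close>
  have cancel_comp: "(ginv G a, gmult G a b) \<in> composable G" "(gmult G a b, ginv G b) \<in> composable G"
    if "(a, b) \<in> composable G" for a b
    using assoc[of "ginv G a" a b] assoc[of a b "ginv G b"] invG(3)[of a] invG[of b]
      invG(3)[of "ginv G b"] sub[OF that] that by auto
  show ?thesis unfolding is_groupoid_def
  proof (intro conjI ballI allI impI)
    show "composable H \<subseteq> arrows H \<times> arrows H"
      unfolding comp img using sub by force
    show "case p of (a, b) \<Rightarrow> gmult H a b \<in> arrows H" if "p \<in> composable H" for p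
      using that sub unfolding comp img by (auto simp: mult)
    show "ginv H x \<in> arrows H" "ginv H (ginv H x) = x" "(ginv H x, x) \<in> composable H"
      if "x \<in> arrows H" for x
      using that invG compI unfolding img by (auto simp: inv)
    show "case p of (a, b) \<Rightarrow> gmult H (ginv H a) (gmult H a b) = b \<and>
        gmult H (gmult H a b) (ginv H b) = a" if "p \<in> composable H" for p
    proof -
      obtain a b where ab: "(a, b) \<in> composable G" "p = (\<phi> a, \<phi> b)"
        using \<open>p \<in> composable H\<close> unfolding comp by auto
      then show ?thesis
        using mult[OF cancel_comp(1)[OF ab(1)]] mult[OF cancel_comp(2)[OF ab(1)]]
        by (simp add: mult sub inv cancel)
    qed
    fix x y z assume xyz: "(x, y) \<in> composable H \<and> (y, z) \<in> composable H"
    then obtain a b b' c where *: "(a, b) \<in> composable G" "(b', c) \<in> composable G"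
      "x = \<phi> a" "y = \<phi> b" "y = \<phi> b'" "z = \<phi> c"
      unfolding comp by auto
    \<comment> \<open>The two preimages of the middle arrow agree by injectivity, so the pairs chain
      up in \<open>G\<close>.\<close>
    then have "b' = b" using inj sub by metis
    with * have bc: "(b, c) \<in> composable G" by simp
    note assoc' = assoc[OF *(1) bc]
    show "(gmult H x y, z) \<in> composable H" "(x, gmult H y z) \<in> composable H"
      "gmult H (gmult H x y) z = gmult H x (gmult H y z)"
      using compI[OF assoc'(1)] compI[OF assoc'(2)] mult[OF assoc'(1)] mult[OF assoc'(2)] assoc'(3)
      by (simp_all add: *(3,4,6) mult[OF *(1)] mult[OF bc])
  qed
qed

text \<open>The operations of \<open>H\<close> are those of \<open>G\<close> conjugated by
  \<open>\<phi>\<close> and its continuous inverse, so their continuity follows by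
  composition.\<close>

lemma topological_groupoid_isomorphism_transport:
  assumes G: "is_topological_groupoid G X" and homeo: "homeomorphic_map X Y \<phi>"
    and arrows: "arrows H = \<phi> ` arrows G"
    and comp: "composable H = map_prod \<phi> \<phi> ` composable G"
    and mult: "\<And>a b. (a, b) \<in> composable G \<Longrightarrow> gmult H (\<phi> a) (\<phi> b) = \<phi> (gmult G a b)"
    and inv: "\<And>a. a \<in> arrows G \<Longrightarrow> ginv H (\<phi> a) = \<phi> (ginv G a)"
  shows "topological_groupoid_isomorphism G X H Y \<phi>"
proof -
  have gG: "is_groupoid G" and topX: "topspace X = arrows G"
    and contm: "continuous_map (subtopology (prod_topology X X) (composable G)) X (\<lambda>(a, b). gmult G a b)"
    and conti: "continuous_map X X (ginv G)"
    using G by (auto simp: is_topological_groupoid_def)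
  obtain \<psi> where hm: "homeomorphic_maps X Y \<phi> \<psi>"
    using homeo homeomorphic_map_maps by blast
  then have \<phi>: "continuous_map X Y \<phi>" and \<psi>: "continuous_map Y X \<psi>"
    and \<psi>\<phi>: "\<And>a. a \<in> arrows G \<Longrightarrow> \<psi> (\<phi> a) = a"
    by (auto simp: homeomorphic_maps_def topX)
  have topY: "topspace Y = arrows H"
    using homeomorphic_imp_surjective_map[OF homeo] by (simp add: arrows topX)
  have "inj_on \<phi> (arrows G)" using \<psi>\<phi> by (rule inj_on_inverseI)
  then have bij: "bij_betw \<phi> (arrows G) (arrows H)" by (simp add: bij_betw_def arrows)
  have gH: "is_groupoid H" using gG bij comp mult inv by (rule is_groupoid_transport)
  have sub: "a \<in> arrows G" "b \<in> arrows G" if "(a, b) \<in> composable G" for a b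
    using gG that unfolding is_groupoid_def by auto
  have "continuous_map (subtopology (prod_topology Y Y) (composable H))
      (subtopology (prod_topology X X) (composable G)) (\<lambda>(x, y). (\<psi> x, \<psi> y))"
  proof (rule continuous_map_into_subtopology)
    show "continuous_map (subtopology (prod_topology Y Y) (composable H))
        (prod_topology X X) (\<lambda>(x, y). (\<psi> x, \<psi> y))"
      using \<psi> by (intro continuous_map_from_subtopology) (simp add: continuous_map_prod_top)
    show "(\<lambda>(x, y). (\<psi> x, \<psi> y)) \<in> topspace (subtopology (prod_topology Y Y) (composable H)) \<rightarrow> composable G"
      using sub by (auto simp: comp \<psi>\<phi>)
  qed
  from continuous_map_compose[OF continuous_map_compose[OF this contm] \<phi>]
  have "continuous_map (subtopology (prod_topology Y Y) (composable H)) Y (\<lambda>(a, b). gmult H a b)"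
    by (rule continuous_map_eq) (use sub in \<open>auto simp: comp mult \<psi>\<phi>\<close>)
  moreover from continuous_map_compose[OF continuous_map_compose[OF \<psi> conti] \<phi>]
  have "continuous_map Y Y (ginv H)"
    by (rule continuous_map_eq) (auto simp: topY arrows inv \<psi>\<phi>)
  ultimately have "is_topological_groupoid H Y"
    using gH topY by (simp add: is_topological_groupoid_def)
  moreover have "groupoid_isomorphism G H \<phi>"
    unfolding groupoid_isomorphism_def using gG gH bij by (auto simp: comp mult)
  ultimately show ?thesis
    using G homeo by (simp add: topological_groupoid_isomorphism_def)
qed


section \<open>Topology\<close>

lemma in_patch_basic:
  "F \<in> patch_basic C s T \<longleftrightarrow> F \<in> proper_filters C \<and> s \<in> F \<and> F \<inter> T = {}"
  using proper_filter_subset by (auto simp: patch_basic_def)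

lemma openin_patch_basic:
  "s \<in> C \<Longrightarrow> finite T \<Longrightarrow> T \<subseteq> down_in C s \<Longrightarrow> openin (patch_topology C) (patch_basic C s T)"
  unfolding patch_topology_def by (rule topology_generated_by_Basis) blast

lemma topspace_patch_topology: "topspace (patch_topology C) = proper_filters C"
  unfolding patch_topology_def topology_generated_by_topspace
proof (intro equalityI subsetI)
  fix F assume F: "F \<in> proper_filters C"
  obtain s where s: "s \<in> F" using proper_filter_nonempty[OF F] by blast
  have "F \<in> patch_basic C s {}" using F s by (simp add: in_patch_basic)
  moreover have "s \<in> C" using proper_filter_subset[OF F] s by blast
  ultimately show "F \<in> \<Union> {patch_basic C s T |s T. s \<in> C \<and> finite T \<and> T \<subseteq> down_in C s}"
    by blast
qed (auto simp: in_patch_basic)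

lemma openin_patch_basic_mult:
  "finite T \<Longrightarrow> T \<subseteq> down_in UNIV s \<Longrightarrow>
    openin (patch_topology UNIV) (patch_basic UNIV (a * s) ((*) a ` T))"
  using nat_le_mult_left by (intro openin_patch_basic) (auto simp: down_in_def)

text \<open>A local criterion suited to filters: the neighbourhood may depend on an element chosen
  from the filter at the point \<open>x\<close>.\<close>

lemma continuous_map_patchI:
  assumes "\<And>x. x \<in> topspace X \<Longrightarrow> f x \<in> proper_filters C"
    and "\<And>s T x. s \<in> C \<Longrightarrow> finite T \<Longrightarrow> T \<subseteq> down_in C s \<Longrightarrow> x \<in> topspace X \<Longrightarrow>
      f x \<in> patch_basic C s T \<Longrightarrow>
      \<exists>U. openin X U \<and> x \<in> U \<and> (\<forall>y\<in>U. f y \<in> patch_basic C s T)"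
  shows "continuous_map X (patch_topology C) f"
  unfolding patch_topology_def
proof (rule continuous_on_generated_topo)
  show "f ` topspace X \<subseteq> \<Union> {patch_basic C s T |s T. s \<in> C \<and> finite T \<and> T \<subseteq> down_in C s}"
    using assms(1) topspace_patch_topology[of C] unfolding patch_topology_def by auto
  fix V assume "V \<in> {patch_basic C s T |s T. s \<in> C \<and> finite T \<and> T \<subseteq> down_in C s}"
  then obtain s T where V: "V = patch_basic C s T" "s \<in> C" "finite T" "T \<subseteq> down_in C s"
    by blast
  show "openin X (f -` V \<inter> topspace X)"
    unfolding openin_subopen[of X "f -` V \<inter> topspace X"]
  proof
    fix x assume "x \<in> f -` V \<inter> topspace X"
    then obtain U where "openin X U" "x \<in> U" "\<forall>y\<in>U. f y \<in> V"
      using assms(2)[OF V(2-4)] V(1) by auto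
    then show "\<exists>U. openin X U \<and> x \<in> U \<and> U \<subseteq> f -` V \<inter> topspace X"
      using openin_subset by blast
  qed
qed

text \<open>Applies \<open>in_filter_mult_iff\<close> to \<open>s\<close> and to each element of
  \<open>T\<close>. The condition depends on \<open>F\<close> only through the element
  \<open>a\<close>, which is what makes multiplication continuous.\<close>

lemma filter_mult_in_patch_basic:
  assumes FG: "(F, G) \<in> composable filter_groupoid" and a: "a \<in> F"
  shows "filter_mult F G \<in> patch_basic UNIV s T \<longleftrightarrow> G \<in> patch_basic UNIV (star a * s) ((*) (star a) ` T)"
proof -
  have *: "F \<in> proper_filters UNIV" "G \<in> proper_filters UNIV"
      "filter_mult (star ` F) F = filter_mult G (star ` G)"
    using FG by (auto simp: filter_groupoid_def)
  show ?thesis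
    using filter_mult_proper[OF *] *(2) in_filter_mult_iff[OF * a]
    by (auto simp: in_patch_basic)
qed

lemma is_topological_groupoid_filter_groupoid:
  "is_topological_groupoid filter_groupoid
    (patch_topology UNIV :: 'a::inverse_semigroup_zero set topology)"
proof -
  let ?P = "patch_topology UNIV :: 'a set topology"
  have "continuous_map (subtopology (prod_topology ?P ?P) (composable filter_groupoid)) ?P
      (\<lambda>(F, G). filter_mult F G)"
  proof (rule continuous_map_patchI)
    fix p assume "p \<in> topspace (subtopology (prod_topology ?P ?P) (composable filter_groupoid))"
    then show "(case p of (F, G) \<Rightarrow> filter_mult F G) \<in> proper_filters UNIV"
      by (auto simp: filter_groupoid_def filter_mult_proper)
  next
    fix s :: 'a and T p
    assume T: "finite T" "T \<subseteq> down_in UNIV s"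
      and p: "p \<in> topspace (subtopology (prod_topology ?P ?P) (composable filter_groupoid))"
        "(case p of (F, G) \<Rightarrow> filter_mult F G) \<in> patch_basic UNIV s T"
    obtain F G where FG: "p = (F, G)" "(F, G) \<in> composable filter_groupoid"
      "F \<in> proper_filters UNIV"
      using p(1) by (cases p) (auto simp: topspace_patch_topology)
    obtain a where a: "a \<in> F" using proper_filter_nonempty[OF FG(3)] by blast
    \<comment> \<open>The first factor keeps \<open>a\<close> in the left filter, so the same
      translate by \<open>star a\<close> is valid throughout \<open>U\<close>.\<close>
    define U where "U = patch_basic UNIV a {} \<times> patch_basic UNIV (star a * s) ((*) (star a) ` T)"
    have "openin (prod_topology ?P ?P) U"
      unfolding U_def using T
      by (auto simp: openin_prod_Times_iff intro: openin_patch_basic openin_patch_basic_mult)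
    then have "openin (subtopology (prod_topology ?P ?P) (composable filter_groupoid))
        (U \<inter> composable filter_groupoid)"
      by (rule openin_subtopology_Int)
    moreover have "p \<in> U"
      using p(2) filter_mult_in_patch_basic[OF FG(2) a] FG a
      by (auto simp: U_def in_patch_basic[of F])
    moreover have "filter_mult F' G' \<in> patch_basic UNIV s T"
      if "(F', G') \<in> U" "(F', G') \<in> composable filter_groupoid" for F' G'
      using that filter_mult_in_patch_basic[OF that(2), of a]
      by (auto simp: U_def in_patch_basic[of F'])
    ultimately show "\<exists>U. openin (subtopology (prod_topology ?P ?P) (composable filter_groupoid)) U \<and>
        p \<in> U \<and> (\<forall>y\<in>U. (case y of (F, G) \<Rightarrow> filter_mult F G) \<in> patch_basic UNIV s T)"
      using FG by (intro exI[of _ "U \<inter> composable filter_groupoid"]) auto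
  qed
  moreover have "continuous_map ?P ?P ((`) star)"
  proof (rule continuous_map_patchI)
    fix s :: 'a and T F
    assume T: "finite T" "T \<subseteq> down_in UNIV s" and F: "star ` F \<in> patch_basic UNIV s T"
    have iff: "star ` F \<in> patch_basic UNIV s T \<longleftrightarrow> F \<in> patch_basic UNIV (star s) (star ` T)" for F
      using star_proper_filter[of F] star_proper_filter[of "star ` F"]
      by (auto simp: in_patch_basic in_star_image)
    have "openin ?P (patch_basic UNIV (star s) (star ` T))"
      using T nat_le_star by (intro openin_patch_basic) (auto simp: down_in_def)
    then show "\<exists>U. openin ?P U \<and> F \<in> U \<and> (\<forall>F\<in>U. star ` F \<in> patch_basic UNIV s T)"
      using F iff by blast
  qed (simp add: topspace_patch_topology star_proper_filter)
  ultimately show ?thesis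
    unfolding is_topological_groupoid_def
    by (simp add: is_groupoid_filter_groupoid topspace_patch_topology)
      (simp add: filter_groupoid_def)
qed

lemma continuous_map_idem_source:
  "continuous_map (patch_topology UNIV) (patch_topology idems) idem_source"
proof (rule continuous_map_patchI)
  fix e X and F :: "'a set"
  assume e: "e \<in> idems" and X: "finite X" "X \<subseteq> down_in idems e"
    and F: "F \<in> topspace (patch_topology UNIV)" "idem_source F \<in> patch_basic idems e X"
  have iff: "idem_source F \<in> patch_basic idems e X \<longleftrightarrow> F \<in> patch_basic UNIV (a * e) ((*) a ` X)"
    if "F \<in> proper_filters UNIV" "a \<in> F" for F a
  proof -
    have "X \<subseteq> idems" using X by (auto simp: down_in_def)
    then show ?thesis
      using that e idem_source_proper[OF that(1)] in_idem_source[OF that]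
      by (auto simp: in_patch_basic)
  qed
  have F': "F \<in> proper_filters UNIV" using F(1) by (simp add: topspace_patch_topology)
  then obtain a where a: "a \<in> F" using proper_filter_nonempty by blast
  have "openin (patch_topology UNIV) (patch_basic UNIV (a * e) ((*) a ` X))"
    using X by (intro openin_patch_basic_mult) (auto simp: down_in_def)
  moreover have "idem_source G \<in> patch_basic idems e X"
    if G: "G \<in> patch_basic UNIV (a * e) ((*) a ` X)" for G
  proof -
    have "G \<in> proper_filters UNIV" "a * e \<in> G" using G by (auto simp: in_patch_basic)
    \<comment> \<open>The translated set already forces \<open>a\<close> into \<open>G\<close>, so
      the test element stays fixed on the whole neighbourhood.\<close>
    then have "a \<in> G" using proper_filter_up nat_le_right[OF e] by blast
    with G show ?thesis using iff \<open>G \<in> proper_filters UNIV\<close> by blast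
  qed
  ultimately show "\<exists>U. openin (patch_topology UNIV) U \<and> F \<in> U \<and>
      (\<forall>G\<in>U. idem_source G \<in> patch_basic idems e X)"
    using iff[OF F' a] F(2) by blast
qed (simp add: topspace_patch_topology idem_source_proper)

section \<open>The germ topology and the homeomorphism\<close>

lemma idem_filters_at_eq: "idem_filters_at e = patch_basic idems e {}"
  by (auto simp: idem_filters_at_def in_patch_basic)

lemma openin_germ_basic:
  "A \<subseteq> idem_filters_at (star s * s) \<Longrightarrow> openin (patch_topology idems) A \<Longrightarrow>
    openin germ_topology (germ_basic s A)"
  unfolding germ_topology_def by (rule topology_generated_by_Basis) blast

lemma topspace_germ_topology: "topspace germ_topology = arrows germ_groupoid"
  unfolding germ_topology_def topology_generated_by_topspace arrows_germ_groupoid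
proof (intro equalityI subsetI)
  fix \<alpha> :: "('a \<times> 'a set) set"
  assume "\<alpha> \<in> {germ s \<xi> |s \<xi>. (s, \<xi>) \<in> germ_pairs}"
  then obtain s \<xi> where \<alpha>: "\<alpha> = germ s \<xi>" and \<xi>: "\<xi> \<in> idem_filters_at (star s * s)"
    by (auto simp: germ_pairs_def)
  have "openin (patch_topology idems) (idem_filters_at (star s * s))"
    unfolding idem_filters_at_eq by (rule openin_patch_basic) auto
  moreover have "\<alpha> \<in> germ_basic s (idem_filters_at (star s * s))"
    using \<alpha> \<xi> by (auto simp: germ_basic_def)
  ultimately show "\<alpha> \<in> \<Union> {germ_basic s A |s A.
      A \<subseteq> idem_filters_at (star s * s) \<and> openin (patch_topology idems) A}" by blast
qed (auto simp: germ_basic_def germ_pairs_def)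

lemma filter_to_germ_in_germ_basic:
  assumes "F \<in> proper_filters UNIV" "A \<subseteq> idem_filters_at (star s * s)"
  shows "filter_to_germ F \<in> germ_basic s A \<longleftrightarrow> s \<in> F \<and> idem_source F \<in> A"
proof -
  have "filter_to_germ F = germ s \<xi> \<longleftrightarrow> s \<in> F \<and> \<xi> = idem_source F" if "\<xi> \<in> A" for \<xi>
    using assms that by (intro filter_to_germ_eq_iff) (auto simp: germ_pairs_def)
  then show ?thesis by (auto simp: germ_basic_def)
qed

lemma homeomorphic_map_filter_to_germ:
  "homeomorphic_map (patch_topology UNIV)
    (germ_topology :: ('a::inverse_semigroup_zero \<times> 'a set) set topology) filter_to_germ"
proof -
  let ?\<pi> = "filter_to_germ :: 'a set \<Rightarrow> _"
  define \<rho> where "\<rho> = inv_into (proper_filters UNIV) ?\<pi>"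
  have \<rho>\<pi>: "\<rho> (?\<pi> F) = F" if "F \<in> proper_filters UNIV" for F
    unfolding \<rho>_def using bij_betw_filter_to_germ that by (rule bij_betw_inv_into_left)
  have img: "arrows germ_groupoid = ?\<pi> ` proper_filters UNIV"
    using bij_betw_filter_to_germ by (auto simp: bij_betw_def)
  have "continuous_map (patch_topology UNIV) germ_topology ?\<pi>"
    unfolding germ_topology_def
  proof (rule continuous_on_generated_topo)
    show "?\<pi> ` topspace (patch_topology UNIV) \<subseteq> \<Union> {germ_basic s A |s A.
        A \<subseteq> idem_filters_at (star s * s) \<and> openin (patch_topology idems) A}"
      using topspace_germ_topology[where 'a='a] img
      by (simp add: germ_topology_def topspace_patch_topology)
    fix V :: "('a \<times> 'a set) set set" assume "V \<in> {germ_basic s A |s A.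
        A \<subseteq> idem_filters_at (star s * s) \<and> openin (patch_topology idems) A}"
    then obtain s A where V: "V = germ_basic s A" and A: "A \<subseteq> idem_filters_at (star s * s)"
      "openin (patch_topology idems) A" by blast
    \<comment> \<open>A germ is in the basic set iff \<open>s\<close> lies in the filter and its
      source idempotents form a member of \<open>A\<close>; both conditions are open.\<close>
    have "?\<pi> -` V \<inter> topspace (patch_topology UNIV) = patch_basic UNIV s {} \<inter>
        {F \<in> topspace (patch_topology UNIV). idem_source F \<in> A}"
      using filter_to_germ_in_germ_basic[OF _ A(1)]
      by (auto simp: V in_patch_basic topspace_patch_topology)
    moreover have "openin (patch_topology UNIV) \<dots>"
      by (intro openin_Int openin_patch_basic
          openin_continuous_map_preimage[OF continuous_map_idem_source A(2)]) auto
    ultimately show "openin (patch_topology UNIV) (?\<pi> -` V \<inter> topspace (patch_topology UNIV))"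
      by simp
  qed
  moreover have "continuous_map germ_topology (patch_topology UNIV) \<rho>"
  proof (rule continuous_map_patchI)
    show "\<rho> x \<in> proper_filters UNIV" if "x \<in> topspace germ_topology" for x
      using that by (auto simp: topspace_germ_topology img \<rho>\<pi>)
    fix s :: 'a and T x
    assume T: "finite T" "T \<subseteq> down_in UNIV s" and x: "x \<in> topspace germ_topology"
      "\<rho> x \<in> patch_basic UNIV s T"
    \<comment> \<open>Translation by \<open>star s\<close> turns the excluded elements
      \<open>t\<close> below \<open>s\<close> into idempotents below \<open>star s * s\<close>. As
      \<open>s * (star s * t) = t\<close>, the filter contains \<open>t\<close> iff its source
      contains \<open>star s * t\<close>, so \<open>germ_basic s A\<close> is the image of the patch
      basic set.\<close>
    define A where "A = patch_basic idems (star s * s) ((*) (star s) ` T)"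
    have T': "(*) (star s) ` T \<subseteq> down_in idems (star s * s)"
      using T(2) nat_le_mult_left[of _ s "star s"] nat_le_idem[of _ "star s * s"]
      by (auto simp: down_in_def)
    have A: "A \<subseteq> idem_filters_at (star s * s)"
      by (auto simp: A_def in_patch_basic idem_filters_at_def)
    have "openin (patch_topology idems) A"
      unfolding A_def using T(1) T' by (intro openin_patch_basic) auto
    then have "openin germ_topology (germ_basic s A)" by (rule openin_germ_basic[OF A])
    moreover have iff: "?\<pi> F \<in> germ_basic s A \<longleftrightarrow> F \<in> patch_basic UNIV s T"
      if F: "F \<in> proper_filters UNIV" for F
    proof -
      have "star s * t \<in> idem_source F \<longleftrightarrow> t \<in> F" if s: "s \<in> F" and t: "t \<in> T" for t
      proof -
        have "t \<preceq> s" using t T(2) by (auto simp: down_in_def)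
        then obtain e where "t = s * e" using nat_leD_right by blast
        then have "s * (star s * t) = t" by simp
        moreover have "star s * t \<in> idems" using t T' by (auto simp: down_in_def)
        ultimately show ?thesis using in_idem_source[OF F s] by simp
      qed
      then have "s \<in> F \<Longrightarrow> idem_source F \<in> A \<longleftrightarrow> F \<in> patch_basic UNIV s T"
        using F idem_source_proper[OF F] star_mult_mem_idem_source[OF F]
        by (auto simp: A_def in_patch_basic)
      then show ?thesis
        using filter_to_germ_in_germ_basic[OF F A] by (auto simp: in_patch_basic)
    qed
    moreover have "\<rho> y \<in> patch_basic UNIV s T" if y: "y \<in> germ_basic s A" for y
    proof -
      have "y \<in> arrows germ_groupoid"
        using y \<open>openin germ_topology (germ_basic s A)\<close> openin_subset topspace_germ_topology by blast
      then show ?thesis using y iff by (auto simp: img \<rho>\<pi>)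
    qed
    moreover have "x \<in> germ_basic s A"
      using x iff by (auto simp: topspace_germ_topology img \<rho>\<pi>)
    ultimately show "\<exists>U. openin germ_topology U \<and> x \<in> U \<and> (\<forall>y\<in>U. \<rho> y \<in> patch_basic UNIV s T)"
      by blast
  qed
  ultimately have "homeomorphic_maps (patch_topology UNIV) germ_topology ?\<pi> \<rho>"
    by (auto simp: homeomorphic_maps_def topspace_patch_topology topspace_germ_topology img \<rho>\<pi>)
  then show ?thesis by (rule homeomorphic_maps_imp_map)
qed

theorem theorem4p1:
  fixes \<pi> :: "'a::inverse_semigroup_zero set \<Rightarrow> ('a \<times> 'a set) set"
  defines "\<pi> \<equiv> filter_to_germ"
  shows "(\<forall>F \<in> proper_filters (UNIV :: 'a set).
            idem_source F \<in> proper_filters idems \<and> (\<forall>s\<in>F. \<pi> F = germ s (idem_source F))) \<and>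
         topological_groupoid_isomorphism
           filter_groupoid (patch_topology UNIV) germ_groupoid germ_topology \<pi> \<and>
         (\<forall>(s, \<xi>) \<in> germ_pairs.
            inv_into (proper_filters UNIV) \<pi> (germ s \<xi>) = up_in UNIV (set_mult {s} \<xi>))"
proof (intro conjI ballI)
  have arrows: "arrows (filter_groupoid :: 'a set groupoid) = proper_filters UNIV"
    and mult: "gmult (filter_groupoid :: 'a set groupoid) = filter_mult"
    and inv: "ginv (filter_groupoid :: 'a set groupoid) = (`) star"
    by (simp_all add: filter_groupoid_def)
  show "topological_groupoid_isomorphism
      filter_groupoid (patch_topology UNIV) germ_groupoid germ_topology \<pi>"
    unfolding \<pi>_def
  proof (rule topological_groupoid_isomorphism_transport)
    show "arrows germ_groupoid = filter_to_germ ` arrows (filter_groupoid :: 'a set groupoid)"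
      using bij_betw_filter_to_germ by (auto simp: arrows bij_betw_def)
  qed (simp_all add: is_topological_groupoid_filter_groupoid homeomorphic_map_filter_to_germ
      composable_germ_groupoid gmult_filter_to_germ ginv_filter_to_germ arrows mult inv)
  show "case p of (s, \<xi>) \<Rightarrow>
      inv_into (proper_filters UNIV) \<pi> (germ s \<xi>) = up_in UNIV (set_mult {s} \<xi>)"
    if "p \<in> germ_pairs" for p
    using that inv_filter_to_germ by (auto simp: \<pi>_def)
qed (simp_all add: idem_source_proper filter_to_germ_eq \<pi>_def)

end
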